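(* Let $K, C \in \mathcal{K}^2$ with $C$ full-dimensional. Then \[ D(K,C) \leq 2R(K,C), \] \[ 4r(K,C) + 2R(K,C) \leq 3D(K,C), \] \[ D(K,C)\bigl(2R(K,C)-D(K,C)\bigr) \leq 4r(K,C)R(K,C). \] Moreover, these three inequalities completely describe the boundary of $f(\mathcal{K}^2,\mathcal{K}^2)$, i.e. \[ f(\mathcal{K}^2,\mathcal{K}^2)=\left\{(x,y)\in[0,1]^2 : y\leq 1,\ 2x+1\leq 3y,\ y(1-y)\leq x\right\}. \]
   Context: $\mathcal{K}^n$ denotes the set of convex bodies, i.e. (nonempty) convex compact subsets of $\mathbb{R}^n$. For $K,C\in\mathcal{K}^n$, with $C$ full-dimensional (the gauge): the circumradius $R(K,C)$ is the smallest $\lambda\geq 0$ such that a translate of $K$ is contained in $\lambda C$; the inradius $r(K,C)$ is the largest $\lambda\geq 0$ such that a translate of $K$ contains $\lambda C$; the diameter is $D(K,C)=2\max_{x,y\in K}R(\{x,y\},C)$. For $K$ not a single point (so that $R(K,C)>0$), define \[ f(K,C)=\left(\frac{r(K,C)}{R(K,C)},\frac{D(K,C)}{2R(K,C)}\right)\in[0,1]^2 . \] $f(\mathcal{K}^n,\mathcal{K}^n)$ denotes the set of all values $f(K,C)$, where $K$ ranges over the elements of $\mathcal{K}^n$ that are not single points and $C$ ranges over the full-dimensional elements of $\mathcal{K}^n$. *)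

theory Defs
  imports "HOL-Analysis.Analysis"
begin

definition convex_bodies :: "'a::euclidean_space set set" where
  "convex_bodies = {K. K \<noteq> {} \<and> convex K \<and> compact K}"

definition full_dimensional :: "'a::euclidean_space set \<Rightarrow> bool" where
  "full_dimensional C \<longleftrightarrow> aff_dim C = int DIM('a)"

text \<open>
  The second argument is always the gauge. No position of the origin relative to the gauge is
  assumed, and the gauge need not be symmetric. For convex bodies with a full-dimensional gauge
  (in positive dimension) the infimum and suprema below are attained, by compactness, so they
  are the minimum and maxima of the usual definitions.
\<close>

definition circumradius :: "'a::euclidean_space set \<Rightarrow> 'a set \<Rightarrow> real" where
  "circumradius K C = Inf {l. 0 \<le> l \<and> (\<exists>t. (+) t ` K \<subseteq> (*\<^sub>R) l ` C)}"

definition inradius :: "'a::euclidean_space set \<Rightarrow> 'a set \<Rightarrow> real" where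
  "inradius K C = Sup {l. 0 \<le> l \<and> (\<exists>t. (*\<^sub>R) l ` C \<subseteq> (+) t ` K)}"

definition gauge_diameter :: "'a::euclidean_space set \<Rightarrow> 'a set \<Rightarrow> real" where
  "gauge_diameter K C = 2 * Sup {circumradius {x, y} C |x y. x \<in> K \<and> y \<in> K}"

definition bs_map :: "'a::euclidean_space set \<Rightarrow> 'a set \<Rightarrow> real \<times> real" where
  "bs_map K C =
     (inradius K C / circumradius K C, gauge_diameter K C / (2 * circumradius K C))"

text \<open>
  The image of \<open>bs_map\<close> (the Blaschke-Santalo diagram). Single points are excluded as \<open>K\<close>
  because their circumradius is 0. The type argument fixes the ambient space.
\<close>

definition bs_diagram :: "'a::euclidean_space itself \<Rightarrow> (real \<times> real) set" where
  "bs_diagram _ = {bs_map K C |K C :: 'a set.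
     K \<in> convex_bodies \<and> \<not> is_singleton K \<and> C \<in> convex_bodies \<and> full_dimensional C}"

end

theory Submission
  imports Defs
begin

text \<open>
  Write \<open>R\<close>, \<open>r\<close>, \<open>D\<close> for circumradius, inradius and diameter, and \<open>d = D / (2 R)\<close>. The inequality
  \<open>D \<le> 2 R\<close> is monotonicity of the circumradius. For the other two, scale and translate so that
  \<open>R = 1\<close> and \<open>K \<subseteq> C\<close>. No smaller copy of \<open>C\<close> contains a translate of \<open>K\<close>, so there are three points of
  \<open>K\<close> on the boundary of \<open>C\<close> with outer normals that sum to \<open>0\<close>
  (\<open>optimal_containment_touching_triple\<close>). The supporting lines at these points bound a triangle \<open>T\<close>
  with \<open>K \<subseteq> C \<subseteq> T\<close>, except in degenerate cases.

  Adding up the widths of \<open>K\<close> and \<open>C\<close> in the three normal directions gives \<open>2 r + 1 \<le> 3 d\<close>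
  (\<open>inscribed_homothet_upper_bound\<close>). The lower bound on \<open>r\<close> comes from the triangle spanned by
  the three touching points. Comparing barycentric coordinates with respect to \<open>T\<close> along the
  chords of \<open>K\<close> shows that each touching point cuts its side of \<open>T\<close> into two parts, each of which is between
  \<open>1 - d\<close> and \<open>d\<close> times the side. The triangle with vertices at these points contains an explicit homothetic copy of \<open>T\<close>, and
  hence one of \<open>C\<close>, of ratio at least \<open>d (1 - d)\<close> (\<open>inscribed_homothet_lower_bound\<close>). If \<open>d = 1\<close> there is
  nothing to show.

  Conversely, every point of the region is attained with a triangle as gauge. For a given diameter,
  \<open>K\<close> ranges over polygons between a triangle with its vertices on the sides of the gauge, for which
  the third inequality is sharp, and a hexagon (possibly degenerate), for which the second one is.
  The polygons in between keep circumradius and diameter, and two explicit families of them give all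
  inradii in between (\<open>bs_diagram_supset\<close>).
\<close>

section \<open>Support functions and optimal containment\<close>

definition support_function :: "'a::euclidean_space set \<Rightarrow> 'a \<Rightarrow> real" where
  "support_function S u = (SUP x\<in>S. u \<bullet> x)"

lemma support_function_upper:
  assumes "compact S" "x \<in> S"
  shows "u \<bullet> x \<le> support_function S u"
proof -
  have "compact ((\<lambda>x. u \<bullet> x) ` S)"
    using assms by (intro compact_continuous_image continuous_intros)
  then show ?thesis
    unfolding support_function_def
    using assms by (intro cSUP_upper bounded_imp_bdd_above compact_imp_bounded)
qed

lemma support_function_attained:
  assumes "compact S" "S \<noteq> {}"
  obtains x where "x \<in> S" "u \<bullet> x = support_function S u"
proof -
  obtain x where x: "x \<in> S" "\<forall>y\<in>S. u \<bullet> y \<le> u \<bullet> x"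
    using continuous_attains_sup[OF assms, of "\<lambda>x. u \<bullet> x"] by (force intro: continuous_intros)
  have "support_function S u = u \<bullet> x"
    unfolding support_function_def using x by (intro cSup_eq_maximum) auto
  with x that show ?thesis by metis
qed

lemma support_function_scaleR:
  assumes "compact S" "S \<noteq> {}" "0 \<le> c"
  shows "support_function S (c *\<^sub>R u) = c * support_function S u"
proof (rule antisym)
  obtain x where x: "x \<in> S" "(c *\<^sub>R u) \<bullet> x = support_function S (c *\<^sub>R u)"
    using support_function_attained[OF assms(1,2)] by blast
  have "c * (u \<bullet> x) \<le> c * support_function S u"
    using support_function_upper[OF assms(1) x(1), of u] assms(3) by (rule mult_left_mono)
  then show "support_function S (c *\<^sub>R u) \<le> c * support_function S u"
    using x by simp
  obtain y where y: "y \<in> S" "u \<bullet> y = support_function S u"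
    using support_function_attained[OF assms(1,2)] by blast
  show "c * support_function S u \<le> support_function S (c *\<^sub>R u)"
    using support_function_upper[OF assms(1) y(1), of "c *\<^sub>R u"] y by simp
qed

lemma continuous_on_support_function:
  assumes "compact S" "S \<noteq> {}"
  shows "continuous_on A (support_function S)"
proof -
  obtain B where B: "\<And>x. x \<in> S \<Longrightarrow> norm x \<le> B"
    using compact_imp_bounded[OF assms(1)] by (auto simp: bounded_iff)
  have B0: "0 \<le> B" using assms(2) B norm_ge_zero order_trans by blast
  have le: "support_function S u \<le> support_function S v + B * norm (u - v)" for u v
  proof -
    obtain x where x: "x \<in> S" "u \<bullet> x = support_function S u"
      using support_function_attained[OF assms] by blast
    have "u \<bullet> x = v \<bullet> x + (u - v) \<bullet> x" by (simp add: inner_diff_left)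
    also have "(u - v) \<bullet> x \<le> norm (u - v) * norm x" by (rule norm_cauchy_schwarz)
    also have "\<dots> \<le> norm (u - v) * B" using B[OF x(1)] by (intro mult_left_mono) auto
    finally show ?thesis
      using support_function_upper[OF assms(1) x(1), of v] x by (simp add: mult.commute)
  qed
  have "B-lipschitz_on UNIV (support_function S)"
    using B0 le unfolding lipschitz_on_def dist_real_def dist_norm
    by (smt (verit) norm_minus_commute)
  then show ?thesis
    using continuous_on_subset lipschitz_on_continuous_on by blast
qed

text \<open>
  By separation, a compact convex set is the intersection of its supporting half-spaces. The point
  of scaling the right-hand sides instead of the set is that the condition becomes linear in
  \<open>(l, y)\<close> jointly, and it stays correct for the degenerate scale \<open>l = 0\<close>.
\<close>

lemma mem_scaled_iff_support_function:
  assumes "convex S" "compact S" "S \<noteq> {}" "0 \<le> l"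
  shows "y \<in> (*\<^sub>R) l ` S \<longleftrightarrow> (\<forall>u. u \<bullet> y \<le> l * support_function S u)"
proof
  assume "y \<in> (*\<^sub>R) l ` S"
  then obtain x where x: "x \<in> S" "y = l *\<^sub>R x" by auto
  show "\<forall>u. u \<bullet> y \<le> l * support_function S u"
    using support_function_upper[OF assms(2) x(1)] x(2) assms(4) by (simp add: mult_left_mono)
next
  assume *: "\<forall>u. u \<bullet> y \<le> l * support_function S u"
  show "y \<in> (*\<^sub>R) l ` S"
  proof (rule ccontr)
    assume "y \<notin> (*\<^sub>R) l ` S"
    moreover have "convex ((*\<^sub>R) l ` S)" "closed ((*\<^sub>R) l ` S)"
      using assms by (auto intro: convex_scaling compact_imp_closed compact_scaling)
    ultimately obtain a b where ab: "a \<bullet> y < b" "\<forall>x\<in>(*\<^sub>R) l ` S. b < a \<bullet> x"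
      using separating_hyperplane_closed_point by blast
    obtain x where x: "x \<in> S" "(-a) \<bullet> x = support_function S (-a)"
      using support_function_attained[OF assms(2,3)] by blast
    have "b < l * (a \<bullet> x)" using ab(2) x(1) by auto
    moreover have "- (a \<bullet> y) \<le> - (l * (a \<bullet> x))" using *[rule_format, of "-a"] x(2)[symmetric] by simp
    ultimately show False using ab(1) by linarith
  qed
qed

lemma translate_subset_scaled_iff:
  assumes "compact K" "K \<noteq> {}" "convex C" "compact C" "C \<noteq> {}" "0 \<le> l"
  shows "(+) t ` K \<subseteq> (*\<^sub>R) l ` C \<longleftrightarrow>
    (\<forall>u. u \<bullet> t + support_function K u \<le> l * support_function C u)"
proof
  assume L: "(+) t ` K \<subseteq> (*\<^sub>R) l ` C"
  show "\<forall>u. u \<bullet> t + support_function K u \<le> l * support_function C u"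
  proof
    fix u
    obtain x where x: "x \<in> K" "u \<bullet> x = support_function K u"
      using support_function_attained[OF assms(1,2)] by blast
    have "t + x \<in> (*\<^sub>R) l ` C" using L x by auto
    then have "u \<bullet> (t + x) \<le> l * support_function C u"
      using mem_scaled_iff_support_function[OF assms(3-6)] by blast
    then show "u \<bullet> t + support_function K u \<le> l * support_function C u"
      using x by (simp add: inner_add_right)
  qed
next
  assume R: "\<forall>u. u \<bullet> t + support_function K u \<le> l * support_function C u"
  show "(+) t ` K \<subseteq> (*\<^sub>R) l ` C"
  proof clarify
    fix x assume "x \<in> K"
    then have "u \<bullet> (t + x) \<le> l * support_function C u" for u
      using R[rule_format, of u] support_function_upper[OF assms(1), of x u]
      by (simp add: inner_add_right)
    then show "t + x \<in> (*\<^sub>R) l ` C"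
      using mem_scaled_iff_support_function[OF assms(3-6)] by blast
  qed
qed

text \<open>
  The optimality condition for containment. If \<open>0\<close> were outside the convex hull of the common
  outer normals, some \<open>v\<close> would have positive inner product with all of them; then \<open>K\<close> pushed
  slightly in direction \<open>- v\<close> loses contact with the boundary of \<open>C\<close> everywhere, and by compactness of
  the unit sphere it would fit into a strictly smaller copy of \<open>C\<close>.
\<close>

lemma touching_normals_surround:
  fixes K C :: "'a::euclidean_space set"
  assumes K: "compact K" "K \<noteq> {}" and C: "convex C" "compact C" "C \<noteq> {}"
    and sub: "K \<subseteq> C"
    and opt: "\<And>l t. 0 \<le> l \<Longrightarrow> (+) t ` K \<subseteq> (*\<^sub>R) l ` C \<Longrightarrow> 1 \<le> l"
  shows "0 \<in> convex hull {u. norm u = 1 \<and> support_function K u = support_function C u}"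
proof (rule ccontr)
  define U where "U = {u. norm u = 1 \<and> support_function K u = support_function C u}"
  let ?g = "\<lambda>u. support_function C u - support_function K u"
  assume "\<not> ?thesis"
  then have 0: "0 \<notin> convex hull U" by (simp add: U_def)
  have cont: "continuous_on A ?g" for A
    using continuous_on_support_function[OF K] continuous_on_support_function[OF C(2,3)]
    by (intro continuous_on_diff)
  have "closed {u \<in> sphere (0::'a) 1. ?g u = 0}"
    using continuous_closed_preimage_constant[OF cont closed_sphere] .
  moreover have U: "U = {u \<in> sphere (0::'a) 1. ?g u = 0}"
    by (auto simp: U_def)
  ultimately have "compact U"
    by (metis (no_types, lifting) compact_eq_bounded_closed bounded_sphere bounded_subset mem_Collect_eq subsetI)
  then have "closed (convex hull U)" by (simp add: compact_convex_hull compact_imp_closed)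
  then obtain v b where v: "0 < b" "\<And>u. u \<in> convex hull U \<Longrightarrow> b < v \<bullet> u"
    using separating_hyperplane_closed_0[OF convex_convex_hull _ 0] by blast
  have vU: "0 < v \<bullet> u" if "u \<in> U" for u
    using v that hull_inc[of u U convex] by force
  have g0: "0 \<le> ?g u" for u
  proof -
    obtain x where "x \<in> K" "u \<bullet> x = support_function K u"
      using support_function_attained[OF K] by blast
    then show ?thesis using support_function_upper[OF C(2), of x u] sub by auto
  qed
  have scompact: "compact (sphere (0::'a) 1)" and sne: "sphere (0::'a) 1 \<noteq> {}"
    by (auto intro: compact_eq_bounded_closed[THEN iffD2])
  \<comment> \<open>Moving \<open>K\<close> slightly in direction \<open>- v\<close> opens a gap in every direction.\<close>
  obtain e where e: "0 < e" "\<And>u. norm u = 1 \<Longrightarrow> 0 < ?g u + e * (v \<bullet> u)"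
  proof (cases "{u \<in> sphere (0::'a) 1. v \<bullet> u \<le> 0} = {}")
    case True
    show ?thesis
    proof (rule that[of 1])
      fix u :: 'a assume "norm u = 1"
      then have "0 < v \<bullet> u" using True by force
      then show "0 < ?g u + 1 * (v \<bullet> u)" using g0[of u] by simp
    qed simp
  next
    case False
    have "closed {u. v \<bullet> u \<le> 0}" by (intro closed_Collect_le continuous_intros)
    then have "compact (sphere 0 1 \<inter> {u. v \<bullet> u \<le> 0})"
      using compact_Int_closed[OF scompact] by blast
    moreover have "sphere 0 1 \<inter> {u. v \<bullet> u \<le> 0} \<noteq> {}" using False by auto
    ultimately obtain w where w: "w \<in> sphere 0 1 \<inter> {u. v \<bullet> u \<le> 0}"
        "\<forall>u \<in> sphere 0 1 \<inter> {u. v \<bullet> u \<le> 0}. ?g w \<le> ?g u"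
      using continuous_attains_inf[OF _ _ cont] by blast
    have "w \<notin> U" using vU[of w] w(1) by auto
    then have gw: "0 < ?g w" using g0[of w] w(1) by (auto simp: U_def)
    show ?thesis
    proof (rule that[of "?g w / (norm v + 1)"])
      have nv: "0 < norm v + 1" by (simp add: add_nonneg_pos)
      show p: "0 < ?g w / (norm v + 1)" using gw nv by simp
      fix u :: 'a assume u: "norm u = 1"
      show "0 < ?g u + ?g w / (norm v + 1) * (v \<bullet> u)"
      proof (cases "v \<bullet> u \<le> 0")
        case True
        have "- (v \<bullet> u) \<le> norm v"
          using norm_cauchy_schwarz[of v "-u"] u by simp
        then have "?g w / (norm v + 1) * (- (v \<bullet> u)) < ?g w / (norm v + 1) * (norm v + 1)"
          using p by (intro mult_strict_left_mono) auto
        also have "\<dots> = ?g w" using nv by simp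
        also have "\<dots> \<le> ?g u" using w(2) True u by auto
        finally show ?thesis by simp
      next
        case False
        then have "0 < ?g w / (norm v + 1) * (v \<bullet> u)" using mult_pos_pos[OF p] by simp
        then show ?thesis using g0[of u] by linarith
      qed
    qed
  qed
  have "continuous_on (sphere 0 1) (\<lambda>u. ?g u + e * (v \<bullet> u))"
    by (intro continuous_intros cont)
  then obtain u0 where u0: "u0 \<in> sphere 0 1"
      "\<forall>u\<in>sphere 0 1. ?g u0 + e * (v \<bullet> u0) \<le> ?g u + e * (v \<bullet> u)"
    using continuous_attains_inf[OF scompact sne] by blast
  define m where "m = ?g u0 + e * (v \<bullet> u0)"
  have m: "0 < m" "\<And>u. norm u = 1 \<Longrightarrow> m \<le> ?g u + e * (v \<bullet> u)"
    unfolding m_def using u0 e(2)[of u0] by auto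
  obtain B where B: "0 \<le> B" "\<And>u. u \<in> sphere 0 1 \<Longrightarrow> norm (support_function C u) \<le> B"
    using continuous_on_compact_bound[OF scompact continuous_on_support_function[OF C(2,3)]]
    by blast
  \<comment> \<open>A gap of at least \<open>m\<close> between support functions leaves room to shrink \<open>C\<close>, because its
    support function is at most \<open>B\<close> on the unit sphere.\<close>
  define l where "l = 1 - min 1 (m / (B + 1))"
  have l: "0 \<le> l" "l < 1" using m(1) B(1) by (auto simp: l_def)
  have small: "(1 - l) * B \<le> m"
  proof -
    have "(1 - l) * B \<le> m / (B + 1) * (B + 1)"
      using B(1) m(1) by (intro mult_mono) (auto simp: l_def)
    then show ?thesis using B(1) by simp
  qed
  have unit: "u \<bullet> (- (e *\<^sub>R v)) + support_function K u \<le> l * support_function C u"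
    if "norm u = 1" for u
  proof -
    have "(1 - l) * support_function C u \<le> (1 - l) * B"
      using B(2)[of u] that l by (intro mult_left_mono) auto
    then have "(1 - l) * support_function C u \<le> ?g u + e * (v \<bullet> u)"
      using small m(2)[OF that] by linarith
    then show ?thesis by (simp add: algebra_simps inner_commute)
  qed
  \<comment> \<open>Both sides are positively homogeneous in \<open>u\<close>, so unit vectors suffice.\<close>
  have "u \<bullet> (- (e *\<^sub>R v)) + support_function K u \<le> l * support_function C u" for u
  proof (cases "u = 0")
    case True
    then show ?thesis
      using support_function_scaleR[OF K, of 0 u] support_function_scaleR[OF C(2,3), of 0 u]
      by simp
  next
    case False
    define w where "w = u /\<^sub>R norm u"
    have u: "u = norm u *\<^sub>R w" "norm w = 1" using False by (auto simp: w_def)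
    have sK: "support_function K u = norm u * support_function K w"
      using support_function_scaleR[OF K, of "norm u" w] u(1) by simp
    have sC: "support_function C u = norm u * support_function C w"
      using support_function_scaleR[OF C(2,3), of "norm u" w] u(1) by simp
    have uv: "u \<bullet> (- (e *\<^sub>R v)) = norm u * (w \<bullet> (- (e *\<^sub>R v)))"
      using u(1) by (metis inner_scaleR_left)
    show ?thesis
      using mult_left_mono[OF unit[OF u(2)], of "norm u"]
      unfolding sK sC uv by (simp add: algebra_simps)
  qed
  then have "(+) (- (e *\<^sub>R v)) ` K \<subseteq> (*\<^sub>R) l ` C"
    using translate_subset_scaled_iff[OF K C l(1)] by blast
  then show False using opt[OF l(1)] l(2) by fastforce
qed

section \<open>Attainment of the circumradius\<close>

lemma full_dimensional_contains_ball:
  fixes C :: "'a::euclidean_space set"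
  assumes "C \<in> convex_bodies" "full_dimensional C"
  obtains z e where "0 < e" "cball z e \<subseteq> C"
proof -
  have "affine hull C = UNIV"
    using assms(2) by (simp add: full_dimensional_def aff_dim_eq_full)
  then have "interior C \<noteq> {}"
    using assms(1) rel_interior_eq_empty[of C] interior_rel_interior[of C]
    by (auto simp: convex_bodies_def rel_interior_interior)
  then show ?thesis using that mem_interior_cball[of _ C] by blast
qed

text \<open>
  In terms of support functions, the pairs of a scale and a translation that place \<open>K\<close> inside the
  gauge form an intersection of closed half-spaces. With the scale bounded by a value \<open>L\<close> that works
  because \<open>C\<close> contains a ball, the set of pairs is compact and nonempty, so the scale has a minimum.
\<close>

lemma circumradius_attained:
  fixes K C :: "'a::euclidean_space set"
  assumes K: "compact K" "K \<noteq> {}" and C: "C \<in> convex_bodies" "full_dimensional C"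
  shows circumradius_nonneg: "0 \<le> circumradius K C"
    and circumradius_containment: "\<exists>t. (+) t ` K \<subseteq> (*\<^sub>R) (circumradius K C) ` C"
    and circumradius_le: "\<And>l t. 0 \<le> l \<Longrightarrow> (+) t ` K \<subseteq> (*\<^sub>R) l ` C \<Longrightarrow> circumradius K C \<le> l"
proof -
  have C': "convex C" "compact C" "C \<noteq> {}" using C by (auto simp: convex_bodies_def)
  obtain z e where z: "0 < e" "cball z e \<subseteq> C"
    using full_dimensional_contains_ball[OF C] .
  obtain M where M: "0 < M" "\<And>x. x \<in> K \<Longrightarrow> norm x \<le> M"
    using compact_imp_bounded[OF K(1)] by (auto simp: bounded_pos)
  obtain N where N: "0 < N" "\<And>x. x \<in> C \<Longrightarrow> norm x \<le> N"
    using compact_imp_bounded[OF C'(2)] by (auto simp: bounded_pos)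
  define L where "L = M / e"
  have L: "0 < L" using M z by (simp add: L_def)
  have big: "(+) (L *\<^sub>R z) ` K \<subseteq> (*\<^sub>R) L ` C"
  proof clarify
    fix x assume x: "x \<in> K"
    have "norm (x /\<^sub>R L) \<le> e"
      using M(2)[OF x] L M(1) z(1) by (simp add: L_def field_simps)
    then have "z + x /\<^sub>R L \<in> C" using z(2) by (auto simp: dist_norm)
    moreover have "L *\<^sub>R z + x = L *\<^sub>R (z + x /\<^sub>R L)" using L by (simp add: scaleR_add_right)
    ultimately show "L *\<^sub>R z + x \<in> (*\<^sub>R) L ` C" by blast
  qed
  define P where "P = {(l::real, t::'a). 0 \<le> l \<and> l \<le> L \<and> (+) t ` K \<subseteq> (*\<^sub>R) l ` C}"
  have Peq: "P = {p. 0 \<le> fst p} \<inter> {p. fst p \<le> L} \<inter>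
      (\<Inter>u. {p. u \<bullet> snd p + support_function K u \<le> fst p * support_function C u})"
    unfolding P_def by (intro set_eqI)
      (simp add: case_prod_beta translate_subset_scaled_iff[OF K C'] cong: conj_cong)
  have "closed P"
    unfolding Peq by (intro closed_Int closed_INT closed_Collect_le ballI continuous_intros)
  moreover have "bounded P"
  proof -
    obtain x where x: "x \<in> K" using K by blast
    have "P \<subseteq> {0..L} \<times> cball 0 (L * N + M)"
    proof clarify
      fix l t assume "(l, t) \<in> P"
      then have l: "0 \<le> l" "l \<le> L" and "t + x \<in> (*\<^sub>R) l ` C" using x by (auto simp: P_def)
      then obtain c where c: "c \<in> C" "t + x = l *\<^sub>R c" by auto
      have "norm (l *\<^sub>R c) \<le> L * N" using l N(2)[OF c(1)] L by (simp add: mult_mono)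
      moreover have "norm t \<le> norm (l *\<^sub>R c) + norm x"
        using norm_triangle_ineq4[of "l *\<^sub>R c" x] c(2) by (metis add_diff_cancel_right')
      ultimately have "norm t \<le> L * N + M" using M(2)[OF x] by linarith
      then show "l \<in> {0..L} \<and> t \<in> cball 0 (L * N + M)" using l by simp
    qed
    then show ?thesis using bounded_subset[OF bounded_Times[OF bounded_closed_interval bounded_cball]] by blast
  qed
  ultimately have "compact P" by (simp add: compact_eq_bounded_closed)
  moreover have "(L, L *\<^sub>R z) \<in> P" using L big by (simp add: P_def)
  ultimately obtain p where p: "p \<in> P" "\<forall>q\<in>P. fst p \<le> fst q"
    using continuous_attains_inf[of P fst] continuous_on_fst[OF continuous_on_id] by blast
  obtain l0 t0 where p0: "p = (l0, t0)" by fastforce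
  have min: "l0 \<le> l" if "0 \<le> l" "(+) t ` K \<subseteq> (*\<^sub>R) l ` C" for l t
  proof (cases "l \<le> L")
    case True
    then show ?thesis using p that unfolding p0 P_def by fastforce
  next
    case False
    then show ?thesis using p(1) by (simp add: p0 P_def)
  qed
  have R: "circumradius K C = l0"
    unfolding circumradius_def using p(1) min
    by (intro cInf_eq_minimum) (auto simp: p0 P_def)
  show "0 \<le> circumradius K C" "\<exists>t. (+) t ` K \<subseteq> (*\<^sub>R) (circumradius K C) ` C"
    using p(1) unfolding R p0 P_def by auto
  show "circumradius K C \<le> l" if "0 \<le> l" "(+) t ` K \<subseteq> (*\<^sub>R) l ` C" for l t
    using min[OF that] R by simp
qed

section \<open>Triangles around a touching configuration\<close>

text \<open>
  In the plane, Caratheodory's theorem reduces the optimality condition to three normals. The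
  convex weights are absorbed into the vectors, which may then vanish or be parallel: two touching
  points on parallel supporting lines are covered as a degenerate case.
\<close>

lemma optimal_containment_touching_triple:
  fixes K C :: "(real^2) set"
  assumes K: "compact K" "K \<noteq> {}" and C: "convex C" "compact C" "C \<noteq> {}"
    and sub: "K \<subseteq> C"
    and opt: "\<And>l t. 0 \<le> l \<Longrightarrow> (+) t ` K \<subseteq> (*\<^sub>R) l ` C \<Longrightarrow> 1 \<le> l"
  obtains v1 v2 v3 p1 p2 p3 where "v1 + v2 + v3 = 0" "\<not> (v1 = 0 \<and> v2 = 0 \<and> v3 = 0)"
    "p1 \<in> K" "p2 \<in> K" "p3 \<in> K"
    "\<forall>x\<in>C. v1 \<bullet> x \<le> v1 \<bullet> p1"
    "\<forall>x\<in>C. v2 \<bullet> x \<le> v2 \<bullet> p2"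
    "\<forall>x\<in>C. v3 \<bullet> x \<le> v3 \<bullet> p3"
proof -
  define U where "U = {u. norm u = 1 \<and> support_function K u = support_function C u}"
  have "0 \<in> convex hull U"
    unfolding U_def by (rule touching_normals_surround) (use assms in auto)
  then obtain S where S: "finite S" "S \<subseteq> U" "card S \<le> 3" "0 \<in> convex hull S"
    using caratheodory[of U] by auto
  have "S \<noteq> {}" using S(4) by auto
  have "\<exists>a b c. S = {a, b, c}"
  proof -
    have "card S \<noteq> 0" using S(1) \<open>S \<noteq> {}\<close> by simp
    then consider "card S = 1" | "card S = 2" | "card S = 3" using S(3) by linarith
    then show ?thesis
    proof cases
      case 1
      then obtain a where "S = {a, a, a}" by (auto simp: card_1_singleton_iff)
      then show ?thesis by blast
    next
      case 2
      then obtain a b where "S = {a, b, b}" by (auto simp: card_2_iff)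
      then show ?thesis by blast
    next
      case 3
      then show ?thesis by (auto simp: card_3_iff)
    qed
  qed
  then obtain a b c where abc: "S = {a, b, c}" by blast
  obtain \<alpha> \<beta> \<gamma> where w: "0 = \<alpha> *\<^sub>R a + \<beta> *\<^sub>R b + \<gamma> *\<^sub>R c" "0 \<le> \<alpha>" "0 \<le> \<beta>" "0 \<le> \<gamma>"
      "\<alpha> + \<beta> + \<gamma> = 1"
    using S(4) unfolding abc convex_hull_3 by auto
  have contact: "\<exists>p\<in>K. \<forall>x\<in>C. (k *\<^sub>R u) \<bullet> x \<le> (k *\<^sub>R u) \<bullet> p" if "u \<in> U" "0 \<le> k" for u k
  proof -
    obtain p where p: "p \<in> K" "u \<bullet> p = support_function K u"
      using support_function_attained[OF K] by blast
    have "u \<bullet> x \<le> u \<bullet> p" if "x \<in> C" for x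
      using support_function_upper[OF C(2) that, of u] p \<open>u \<in> U\<close> by (simp add: U_def)
    then show ?thesis using p(1) \<open>0 \<le> k\<close> by (auto intro!: bexI[of _ p] mult_left_mono)
  qed
  have U: "a \<in> U" "b \<in> U" "c \<in> U" using S(2) abc by auto
  have nz: "a \<noteq> 0" "b \<noteq> 0" "c \<noteq> 0" using U by (auto simp: U_def)
  obtain p1 p2 p3 where "p1 \<in> K" "p2 \<in> K" "p3 \<in> K"
    "\<forall>x\<in>C. (\<alpha> *\<^sub>R a) \<bullet> x \<le> (\<alpha> *\<^sub>R a) \<bullet> p1"
    "\<forall>x\<in>C. (\<beta> *\<^sub>R b) \<bullet> x \<le> (\<beta> *\<^sub>R b) \<bullet> p2"
    "\<forall>x\<in>C. (\<gamma> *\<^sub>R c) \<bullet> x \<le> (\<gamma> *\<^sub>R c) \<bullet> p3"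
    using contact[OF U(1) w(2)] contact[OF U(2) w(3)] contact[OF U(3) w(4)] by blast
  moreover have "\<alpha> *\<^sub>R a + \<beta> *\<^sub>R b + \<gamma> *\<^sub>R c = 0" using w(1) by simp
  moreover have "\<not> (\<alpha> *\<^sub>R a = 0 \<and> \<beta> *\<^sub>R b = 0 \<and> \<gamma> *\<^sub>R c = 0)" using w(5) nz by auto
  ultimately show ?thesis using that by blast
qed

text \<open>
  The quantity \<open>h1 + h2 + h3\<close> is unchanged under translations of the half-planes
  \<open>v\<^sub>i \<bullet> x \<le> h\<^sub>i\<close>, since the normals sum to \<open>0\<close>. It measures the size of the triangle that they bound,
  so a ball inside forces it to be positive.
\<close>

lemma sum_heights_positive:
  fixes C :: "'a::euclidean_space set"
  assumes ball: "0 < e" "cball z e \<subseteq> C"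
    and v: "v1 + v2 + v3 = 0" "\<not> (v1 = 0 \<and> v2 = 0 \<and> v3 = 0)"
    and sup: "\<And>x. x \<in> C \<Longrightarrow> v1 \<bullet> x \<le> h1" "\<And>x. x \<in> C \<Longrightarrow> v2 \<bullet> x \<le> h2"
      "\<And>x. x \<in> C \<Longrightarrow> v3 \<bullet> x \<le> h3"
  shows "0 < h1 + h2 + h3"
proof -
  have h: "v \<bullet> z + e * norm v \<le> h" if "\<And>x. x \<in> C \<Longrightarrow> v \<bullet> x \<le> h" for v h
  proof -
    have "z + e *\<^sub>R (v /\<^sub>R norm v) \<in> C"
      using ball by (intro subsetD[OF ball(2)]) (cases "v = 0"; simp add: dist_norm)
    moreover have "v \<bullet> (v /\<^sub>R norm v) = norm v"
      by (cases "v = 0") (simp_all add: dot_square_norm power2_eq_square)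
    ultimately show ?thesis using that[of "z + e *\<^sub>R (v /\<^sub>R norm v)"] by (simp only: inner_add_right inner_scaleR_right)
  qed
  have "v1 \<bullet> z + v2 \<bullet> z + v3 \<bullet> z = 0"
    using v(1) by (metis inner_add_left inner_zero_left)
  moreover have "0 < e * norm v1 + e * norm v2 + e * norm v3"
    using v(2) ball(1) by (smt (verit) mult_nonneg_nonneg norm_ge_zero zero_less_mult_iff zero_less_norm_iff)
  ultimately show ?thesis using h[OF sup(1)] h[OF sup(2)] h[OF sup(3)] by linarith
qed

text \<open>
  For convex \<open>C\<close>, this says \<open>K - K \<subseteq> d (C - C)\<close>: every chord of \<open>K\<close> is at most \<open>d\<close> times a parallel
  chord of \<open>C\<close>. For a full-dimensional gauge the least such \<open>d\<close> is half the diameter.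
\<close>

definition differences_within :: "real \<Rightarrow> 'a::real_vector set \<Rightarrow> 'a set \<Rightarrow> bool" where
  "differences_within d K C \<longleftrightarrow>
    (\<forall>x\<in>K. \<forall>y\<in>K. \<exists>r\<in>{0..d}. \<exists>p\<in>C. \<exists>q\<in>C. x - y = r *\<^sub>R (p - q))"

lemma differences_within_width:
  fixes K C :: "'a::real_inner set"
  assumes "differences_within d K C" "x \<in> K" "y \<in> K"
    and "\<And>z. z \<in> C \<Longrightarrow> v \<bullet> z \<le> M" "\<And>z. z \<in> C \<Longrightarrow> m \<le> v \<bullet> z"
  shows "v \<bullet> x - v \<bullet> y \<le> d * (M - m)"
proof -
  obtain r p q where r: "0 \<le> r" "r \<le> d" "p \<in> C" "q \<in> C" "x - y = r *\<^sub>R (p - q)"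
    using assms(1-3) unfolding differences_within_def by fastforce
  have "v \<bullet> x - v \<bullet> y = v \<bullet> (x - y)" by (simp add: inner_diff_right)
  also have "\<dots> = r * (v \<bullet> p - v \<bullet> q)" using r(5) by (simp add: inner_diff_right)
  also have "\<dots> \<le> r * (M - m)" using assms(4)[OF r(3)] assms(5)[OF r(4)] r(1)
    by (intro mult_left_mono) auto
  also have "\<dots> \<le> d * (M - m)" using r(2) assms(4,5)[OF r(3)]
    by (intro mult_right_mono) auto
  finally show ?thesis .
qed

text \<open>
  Compare the widths of \<open>K\<close> and \<open>C\<close> in the three normal directions and add. The upper supporting
  values agree for \<open>K\<close> and \<open>C\<close>; let \<open>H\<close> be their sum, and let \<open>G\<close> be the sum of the support values of
  \<open>C\<close> in the opposite directions. The inscribed copy of \<open>C\<close> makes the total width of \<open>K\<close> at least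
  \<open>H + l G\<close>, hence \<open>H + l G \<le> d (H + G)\<close>. Since \<open>C\<close> lies in the triangle cut out by the three
  supporting lines, \<open>G \<le> 2 H\<close>, and this is the worst case.
\<close>

lemma inscribed_homothet_upper_bound:
  fixes K C :: "'a::euclidean_space set"
  assumes C: "compact C" and ball: "0 < e" "cball z e \<subseteq> C" and sub: "K \<subseteq> C"
    and v: "v1 + v2 + v3 = 0" "\<not> (v1 = 0 \<and> v2 = 0 \<and> v3 = 0)"
    and p: "p1 \<in> K" "p2 \<in> K" "p3 \<in> K"
    and sup: "\<And>x. x \<in> C \<Longrightarrow> v1 \<bullet> x \<le> v1 \<bullet> p1" "\<And>x. x \<in> C \<Longrightarrow> v2 \<bullet> x \<le> v2 \<bullet> p2"
      "\<And>x. x \<in> C \<Longrightarrow> v3 \<bullet> x \<le> v3 \<bullet> p3"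
    and d: "differences_within d K C"
    and l: "\<And>x. x \<in> C \<Longrightarrow> s + l *\<^sub>R x \<in> K"
  shows "2 * l + 1 \<le> 3 * d"
proof -
  have zero: "v1 \<bullet> x + v2 \<bullet> x + v3 \<bullet> x = 0" for x
    using v(1) by (metis inner_add_left inner_zero_left)
  define H where "H = v1 \<bullet> p1 + v2 \<bullet> p2 + v3 \<bullet> p3"
  have H: "0 < H" unfolding H_def by (rule sum_heights_positive[OF ball v sup])
  have "C \<noteq> {}" using p sub by blast
  then have min: "\<exists>y\<in>C. \<forall>x\<in>C. v \<bullet> y \<le> v \<bullet> x" for v
    using continuous_attains_inf[OF C, of "\<lambda>x. v \<bullet> x"] by (force intro: continuous_intros)
  obtain y1 y2 y3 where y: "y1 \<in> C" "y2 \<in> C" "y3 \<in> C"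
      "\<And>x. x \<in> C \<Longrightarrow> v1 \<bullet> y1 \<le> v1 \<bullet> x" "\<And>x. x \<in> C \<Longrightarrow> v2 \<bullet> y2 \<le> v2 \<bullet> x"
      "\<And>x. x \<in> C \<Longrightarrow> v3 \<bullet> y3 \<le> v3 \<bullet> x"
    using min[of v1] min[of v2] min[of v3] by blast
  define G where "G = - (v1 \<bullet> y1 + v2 \<bullet> y2 + v3 \<bullet> y3)"
  have G: "G \<le> 2 * H"
  proof -
    have "- (v1 \<bullet> y1) \<le> v2 \<bullet> p2 + v3 \<bullet> p3" using sup(2,3)[OF y(1)] zero[of y1] by linarith
    moreover have "- (v2 \<bullet> y2) \<le> v1 \<bullet> p1 + v3 \<bullet> p3" using sup(1,3)[OF y(2)] zero[of y2] by linarith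
    moreover have "- (v3 \<bullet> y3) \<le> v1 \<bullet> p1 + v2 \<bullet> p2" using sup(1,2)[OF y(3)] zero[of y3] by linarith
    ultimately show ?thesis unfolding G_def H_def by argo
  qed
  have w: "v \<bullet> p - v \<bullet> s - l * (v \<bullet> y) \<le> d * (v \<bullet> p - v \<bullet> y)"
    if "p \<in> K" "y \<in> C" "\<And>x. x \<in> C \<Longrightarrow> v \<bullet> x \<le> v \<bullet> p" "\<And>x. x \<in> C \<Longrightarrow> v \<bullet> y \<le> v \<bullet> x" for v p y
    using differences_within_width[OF d that(1) l[OF that(2)] that(3,4)]
    by (simp add: inner_add_right)
  have HG: "H + l * G \<le> d * (H + G)"
    using w[OF p(1) y(1) sup(1) y(4)] w[OF p(2) y(2) sup(2) y(5)] w[OF p(3) y(3) sup(3) y(6)] zero[of s]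
    unfolding H_def G_def by (simp add: algebra_simps)
  have "l * H \<le> H"
  proof -
    have pC: "p1 \<in> C" "p2 \<in> C" "p3 \<in> C" using p sub by auto
    have "v1 \<bullet> s + l * (v1 \<bullet> p1) \<le> v1 \<bullet> p1" "v2 \<bullet> s + l * (v2 \<bullet> p2) \<le> v2 \<bullet> p2"
      "v3 \<bullet> s + l * (v3 \<bullet> p3) \<le> v3 \<bullet> p3"
      using sup(1)[OF subsetD[OF sub l[OF pC(1)]]] sup(2)[OF subsetD[OF sub l[OF pC(2)]]]
        sup(3)[OF subsetD[OF sub l[OF pC(3)]]] by (simp_all add: inner_add_right)
    then show ?thesis using zero[of s] unfolding H_def distrib_left by argo
  qed
  then have l1: "l \<le> 1" using H by simp
  have "0 < (- v1) \<bullet> y1 + (- v2) \<bullet> y2 + (- v3) \<bullet> y3"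
  proof (rule sum_heights_positive[OF ball])
    have "- v1 + - v2 + - v3 = - (v1 + v2 + v3)" by simp
    then show "- v1 + - v2 + - v3 = 0" using v(1) by simp
    show "\<not> (- v1 = 0 \<and> - v2 = 0 \<and> - v3 = 0)" using v(2) by simp
  qed (use y in auto)
  then have G0: "0 < G" by (simp add: G_def)
  have "l \<le> d"
  proof (rule ccontr)
    assume "\<not> l \<le> d"
    moreover have "l * (H + G) \<le> d * (H + G)"
      using HG mult_right_mono[OF l1, of H] H unfolding distrib_left by linarith
    ultimately show False using G0 H by (simp add: mult_le_cancel_right)
  qed
  then have "G * (d - l) \<le> 2 * H * (d - l)" using G by (intro mult_right_mono) auto
  then have "H * (2 * l + 1) \<le> H * (3 * d)" using HG by (simp add: algebra_simps)
  then show ?thesis using H by simp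
qed

text \<open>
  The right-hand side is affine in each variable, so its minimum over the cube is at a vertex, where
  its value is \<open>d (1 - d)\<close> or \<open>1 - 3 d (1 - d)\<close>. Interpolating from the vertices writes \<open>2 d - 1\<close>
  times the difference of the two sides as a sum of two nonnegative products.
\<close>

lemma cyclic_product_lower_bound:
  fixes a b c d :: real
  assumes a: "1 - d \<le> a" "a \<le> d" and b: "1 - d \<le> b" "b \<le> d" and c: "1 - d \<le> c" "c \<le> d"
  shows "d * (1 - d) \<le> a * b * c + (1 - a) * (1 - b) * (1 - c)"
proof (cases "d = 1/2")
  case True
  then have "a = 1/2" "b = 1/2" "c = 1/2" using assms by auto
  then show ?thesis by (simp only: True) simp
next
  case False
  then have d: "0 < 2 * d - 1" using a by linarith
  have "0 \<le> (a - (1 - d)) * ((b - (1 - d)) * (c - (1 - d))) + (d - a) * ((d - b) * (d - c))"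
    using assms by (intro add_nonneg_nonneg mult_nonneg_nonneg) auto
  also have "\<dots> = (2 * d - 1) * (a * b * c + (1 - a) * (1 - b) * (1 - c) - d * (1 - d))"
    by (simp add: algebra_simps)
  finally have "0 \<le> a * b * c + (1 - a) * (1 - b) * (1 - c) - d * (1 - d)"
    using d by (meson leD not_less mult_pos_neg)
  then show ?thesis by simp
qed

lemma orthogonal_plane_multiple:
  fixes d v :: "real^2"
  assumes "d \<noteq> 0" "v \<bullet> d = 0"
  obtains s where "v = s *\<^sub>R vector [- d $ 2, d $ 1]"
proof (cases "d $ 1 = 0")
  case True
  then have d2: "d $ 2 \<noteq> 0" using assms(1) by (auto simp: vec_eq_iff forall_2)
  then have "v $ 2 = 0" using assms(2) True by (simp add: inner_vec_def sum_2)
  then show ?thesis using that[of "- v $ 1 / d $ 2"] d2 True by (simp add: vec_eq_iff forall_2)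
next
  case False
  then have "v $ 1 = - v $ 2 * d $ 2 / d $ 1"
    using assms(2) by (simp add: inner_vec_def sum_2 field_simps)
  then show ?thesis using that[of "v $ 2 / d $ 1"] False by (simp add: vec_eq_iff forall_2)
qed

text \<open>
  Let \<open>X1, X2, X3\<close> be the barycentric coordinates with respect to the triangle \<open>T\<close> bounded by the
  three supporting lines. They lie in \<open>[0, 1]\<close> on \<open>C\<close>, so along any chord of \<open>K\<close> they change by at most
  \<open>d\<close>. A touching point has one coordinate \<open>0\<close>; comparing it with the other two bounds the remaining
  coordinates of each touching point:
  \<open>p1 = (0, a, 1 - a)\<close>, \<open>p2 = (1 - b, 0, b)\<close>, \<open>p3 = (c, 1 - c, 0)\<close> with \<open>a, b, c\<close> in \<open>[1 - d, d]\<close>.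

  The triangle with vertices \<open>p1, p2, p3\<close> contains a translate of \<open>l T\<close>, hence of \<open>l C\<close>, where
  \<open>l = a b c + (1 - a) (1 - b) (1 - c)\<close> is the ratio of the areas of the two triangles. The three
  vertices of the copy are \<open>(1 - a) p2 + a p3\<close>, \<open>(1 - b) p3 + b p1\<close> and \<open>(1 - c) p1 + c p2\<close>.
\<close>

lemma inscribed_homothet_lower_bound:
  fixes K C :: "(real^2) set"
  assumes K: "convex K" and ball: "0 < e" "cball z e \<subseteq> C" and sub: "K \<subseteq> C"
    and v: "v1 + v2 + v3 = 0" "\<not> (v1 = 0 \<and> v2 = 0 \<and> v3 = 0)"
    and p: "p1 \<in> K" "p2 \<in> K" "p3 \<in> K"
    and sup: "\<And>x. x \<in> C \<Longrightarrow> v1 \<bullet> x \<le> v1 \<bullet> p1" "\<And>x. x \<in> C \<Longrightarrow> v2 \<bullet> x \<le> v2 \<bullet> p2"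
      "\<And>x. x \<in> C \<Longrightarrow> v3 \<bullet> x \<le> v3 \<bullet> p3"
    and d: "differences_within d K C" "0 \<le> d" "d < 1"
  obtains l w where "d * (1 - d) \<le> l" "0 \<le> l" "\<forall>x\<in>C. w + l *\<^sub>R x \<in> K"
proof -
  have zero: "v1 \<bullet> x + v2 \<bullet> x + v3 \<bullet> x = 0" for x
    using v(1) by (metis inner_add_left inner_zero_left)
  define H where "H = v1 \<bullet> p1 + v2 \<bullet> p2 + v3 \<bullet> p3"
  have H: "0 < H" unfolding H_def by (rule sum_heights_positive[OF ball v sup])
  define X1 where "X1 x = (v1 \<bullet> p1 - v1 \<bullet> x) / H" for x
  define X2 where "X2 x = (v2 \<bullet> p2 - v2 \<bullet> x) / H" for x
  define X3 where "X3 x = (v3 \<bullet> p3 - v3 \<bullet> x) / H" for x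
  have X1: "v1 \<bullet> x = v1 \<bullet> p1 - H * X1 x" for x using H by (simp add: X1_def)
  have X2: "v2 \<bullet> x = v2 \<bullet> p2 - H * X2 x" for x using H by (simp add: X2_def)
  have X3: "v3 \<bullet> x = v3 \<bullet> p3 - H * X3 x" for x using H by (simp add: X3_def)
  have X_sum: "X1 x + X2 x + X3 x = 1" for x
  proof -
    have "H * (X1 x + X2 x + X3 x) = H"
      using X1[of x] X2[of x] X3[of x] zero[of x] unfolding H_def by (simp add: distrib_left)
    then show ?thesis using H by simp
  qed
  have X_nonneg: "0 \<le> X1 x" "0 \<le> X2 x" "0 \<le> X3 x" if "x \<in> C" for x
    using sup[OF that] H by (auto simp: X1_def X2_def X3_def)
  have X_le: "X1 x \<le> 1" "X2 x \<le> 1" "X3 x \<le> 1" if "x \<in> C" for x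
    using X_nonneg[OF that] X_sum[of x] by auto
  have diff: "f x \<le> d" if f: "f = X1 \<and> f y = 0 \<or> f = X2 \<and> f y = 0 \<or> f = X3 \<and> f y = 0"
    and xy: "x \<in> K" "y \<in> K" for f x y
  proof -
    obtain r p q where r: "0 \<le> r" "r \<le> d" "p \<in> C" "q \<in> C" "x - y = r *\<^sub>R (p - q)"
      using d(1) xy unfolding differences_within_def by fastforce
    have "v \<bullet> x - v \<bullet> y = r * (v \<bullet> p - v \<bullet> q)" for v
      using arg_cong[OF r(5), of "\<lambda>x. v \<bullet> x"] by (simp add: inner_diff_right)
    from this[of v1] this[of v2] this[of v3]
    have "H * (X1 x - X1 y) = H * (r * (X1 p - X1 q))" "H * (X2 x - X2 y) = H * (r * (X2 p - X2 q))"
      "H * (X3 x - X3 y) = H * (r * (X3 p - X3 q))"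
      unfolding X1[of x] X1[of y] X1[of p] X1[of q] X2[of x] X2[of y] X2[of p] X2[of q]
        X3[of x] X3[of y] X3[of p] X3[of q]
      by (simp_all add: algebra_simps)
    then have "X1 x - X1 y = r * (X1 p - X1 q)" "X2 x - X2 y = r * (X2 p - X2 q)"
      "X3 x - X3 y = r * (X3 p - X3 q)"
      using H by simp_all
    then have "f x = r * (f p - f q)" using f by auto
    also have "\<dots> \<le> r * 1" using f X_nonneg[OF r(4)] X_le[OF r(3)] r(1) by (intro mult_left_mono) auto
    finally show ?thesis using r(2) by simp
  qed
  define a where "a = X2 p1"
  define b where "b = X3 p2"
  define c where "c = X1 p3"
  have P1: "X1 p1 = 0" "X2 p1 = a" "X3 p1 = 1 - a"
    using X_sum[of p1] by (auto simp: X1_def a_def)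
  have P2: "X1 p2 = 1 - b" "X2 p2 = 0" "X3 p2 = b"
    using X_sum[of p2] by (auto simp: X2_def b_def)
  have P3: "X1 p3 = c" "X2 p3 = 1 - c" "X3 p3 = 0"
    using X_sum[of p3] by (auto simp: X3_def c_def)
  have a: "1 - d \<le> a" "a \<le> d"
    using diff[of X3 p3 p1] diff[of X2 p2 p1] P1 P2 P3 p by auto
  have b: "1 - d \<le> b" "b \<le> d"
    using diff[of X1 p1 p2] diff[of X3 p3 p2] P1 P2 P3 p by auto
  have c: "1 - d \<le> c" "c \<le> d"
    using diff[of X2 p2 p3] diff[of X1 p1 p3] P1 P2 P3 p by auto
  \<comment> \<open>The normals span the plane, so barycentric coordinates determine a point: if all normals were
    multiples of one vector, then, as each touching point lies on only one of the three lines, the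
    multiples would have pairwise opposite signs, which three numbers cannot have.\<close>
  have span: "u = 0" if u: "v1 \<bullet> u = 0" "v2 \<bullet> u = 0" "v3 \<bullet> u = 0" for u
  proof (rule ccontr)
    assume "u \<noteq> 0"
    define n :: "real^2" where "n = vector [- u $ 2, u $ 1]"
    obtain s1 s2 s3 where s: "v1 = s1 *\<^sub>R n" "v2 = s2 *\<^sub>R n" "v3 = s3 *\<^sub>R n"
      using orthogonal_plane_multiple[OF \<open>u \<noteq> 0\<close>] u unfolding n_def by metis
    have "0 < H * a" "0 < H * b" "0 < H * c" "0 < H * (1 - a)" "0 < H * (1 - b)" "0 < H * (1 - c)"
      using H a b c d(3) by auto
    then have "v2 \<bullet> p1 < v2 \<bullet> p2" "v3 \<bullet> p1 < v3 \<bullet> p3" "v1 \<bullet> p2 < v1 \<bullet> p1" "v3 \<bullet> p2 < v3 \<bullet> p3"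
      "v1 \<bullet> p3 < v1 \<bullet> p1" "v2 \<bullet> p3 < v2 \<bullet> p2"
      using X2[of p1] X3[of p1] X1[of p2] X3[of p2] X1[of p3] X2[of p3] P1 P2 P3 by auto
    then have pos: "0 < s2 * (n \<bullet> p2 - n \<bullet> p1)" "0 < s1 * (n \<bullet> p1 - n \<bullet> p2)"
      "0 < s3 * (n \<bullet> p3 - n \<bullet> p2)" "0 < s2 * (n \<bullet> p2 - n \<bullet> p3)"
      "0 < s3 * (n \<bullet> p3 - n \<bullet> p1)" "0 < s1 * (n \<bullet> p1 - n \<bullet> p3)"
      by (auto simp: s right_diff_distrib)
    then show False by (auto simp: zero_less_mult_iff)
  qed
  define l where "l = a * b * c + (1 - a) * (1 - b) * (1 - c)"
  define w where "w = (b * (1 - c)) *\<^sub>R p1 + (c * (1 - a)) *\<^sub>R p2 + (a * (1 - b)) *\<^sub>R p3"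
  show ?thesis
  proof (rule that[of l w])
    show dl: "d * (1 - d) \<le> l"
      unfolding l_def using a b c by (rule cyclic_product_lower_bound)
    then show "0 \<le> l" using d(2,3) mult_nonneg_nonneg[of d "1 - d"] by linarith
    show "\<forall>x\<in>C. w + l *\<^sub>R x \<in> K"
    proof
      fix x assume x: "x \<in> C"
      define x1 where "x1 = X1 x"
      define x2 where "x2 = X2 x"
      have x3: "X3 x = 1 - x1 - x2" using X_sum[of x] by (simp add: x1_def x2_def)
      \<comment> \<open>The weights of \<open>p1, p2, p3\<close> in the point of the copy of \<open>T\<close> that corresponds to \<open>x\<close>.\<close>
      define k1 where "k1 = x2 * b + (1 - x1 - x2) * (1 - c)"
      define k2 where "k2 = x1 * (1 - a) + (1 - x1 - x2) * c"
      define k3 where "k3 = x1 * a + x2 * (1 - b)"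
      have "0 \<le> x1" "0 \<le> x2" "0 \<le> 1 - x1 - x2"
        using X_nonneg[OF x] x3 by (auto simp: x1_def x2_def)
      then have k: "0 \<le> k1" "0 \<le> k2" "0 \<le> k3"
        unfolding k1_def k2_def k3_def using a b c d(3)
        by (auto intro!: add_nonneg_nonneg mult_nonneg_nonneg)
      have ksum: "k1 + k2 + k3 = 1" by (simp add: k1_def k2_def k3_def algebra_simps)
      have "k1 *\<^sub>R p1 + k2 *\<^sub>R p2 + k3 *\<^sub>R p3 \<in> convex hull {p1, p2, p3}"
        unfolding convex_hull_3 using k ksum by blast
      moreover have "convex hull {p1, p2, p3} \<subseteq> K"
        using p K by (intro hull_minimal) auto
      moreover have "w + l *\<^sub>R x - (k1 *\<^sub>R p1 + k2 *\<^sub>R p2 + k3 *\<^sub>R p3) = 0"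
      proof (rule span)
        show "v1 \<bullet> (w + l *\<^sub>R x - (k1 *\<^sub>R p1 + k2 *\<^sub>R p2 + k3 *\<^sub>R p3)) = 0"
          unfolding w_def
          by (simp add: inner_add_right inner_diff_right X1[of p2] X1[of p3] X1[of x] P2 P3 x1_def[symmetric])
            (simp add: k1_def k2_def k3_def l_def algebra_simps)
        show "v2 \<bullet> (w + l *\<^sub>R x - (k1 *\<^sub>R p1 + k2 *\<^sub>R p2 + k3 *\<^sub>R p3)) = 0"
          unfolding w_def
          by (simp add: inner_add_right inner_diff_right X2[of p1] X2[of p3] X2[of x] P1 P3 x2_def[symmetric])
            (simp add: k1_def k2_def k3_def l_def algebra_simps)
        show "v3 \<bullet> (w + l *\<^sub>R x - (k1 *\<^sub>R p1 + k2 *\<^sub>R p2 + k3 *\<^sub>R p3)) = 0"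
          unfolding w_def
          by (simp add: inner_add_right inner_diff_right X3[of p1] X3[of p2] X3[of x] P1 P2 x3)
            (simp add: k1_def k2_def k3_def l_def algebra_simps)
      qed
      ultimately show "w + l *\<^sub>R x \<in> K" by auto
    qed
  qed
qed

section \<open>Diameter and inradius of convex bodies\<close>

lemma circumradius_pair_le:
  fixes K C :: "'a::euclidean_space set"
  assumes K: "K \<in> convex_bodies" and C: "C \<in> convex_bodies" "full_dimensional C"
    and xy: "x \<in> K" "y \<in> K"
  shows "circumradius {x, y} C \<le> circumradius K C"
proof -
  have K': "compact K" "K \<noteq> {}" using K by (auto simp: convex_bodies_def)
  obtain t where t: "0 \<le> circumradius K C" "(+) t ` K \<subseteq> (*\<^sub>R) (circumradius K C) ` C"
    using circumradius_nonneg[OF K' C] circumradius_containment[OF K' C] by blast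
  then have "(+) t ` {x, y} \<subseteq> (*\<^sub>R) (circumradius K C) ` C" using xy by blast
  moreover have "compact {x, y}" "{x, y} \<noteq> {}" by auto
  ultimately show ?thesis using circumradius_le[OF _ _ C t(1)] by blast
qed

lemma half_gauge_diameter_bounds:
  fixes K C :: "'a::euclidean_space set"
  assumes K: "K \<in> convex_bodies" and C: "C \<in> convex_bodies" "full_dimensional C"
  shows "x \<in> K \<Longrightarrow> y \<in> K \<Longrightarrow> circumradius {x, y} C \<le> gauge_diameter K C / 2"
    and "0 \<le> gauge_diameter K C"
    and "gauge_diameter K C \<le> 2 * circumradius K C"
proof -
  let ?S = "{circumradius {x, y} C |x y. x \<in> K \<and> y \<in> K}"
  have up: "\<And>s. s \<in> ?S \<Longrightarrow> s \<le> circumradius K C"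
    using circumradius_pair_le[OF K C] by blast
  then have bdd: "bdd_above ?S" by (meson bdd_aboveI)
  show le: "circumradius {x, y} C \<le> gauge_diameter K C / 2" if "x \<in> K" "y \<in> K" for x y
  proof -
    have "circumradius {x, y} C \<le> Sup ?S" using that by (intro cSup_upper bdd) blast
    then show ?thesis by (simp add: gauge_diameter_def)
  qed
  obtain x where x: "x \<in> K" using K by (auto simp: convex_bodies_def)
  have "0 \<le> circumradius {x, x} C"
    by (rule circumradius_nonneg[OF _ _ C]) auto
  then show "0 \<le> gauge_diameter K C" using le[OF x x] by linarith
  have "?S \<noteq> {}" using x by blast
  then have "Sup ?S \<le> circumradius K C" using up by (rule cSup_least)
  then show "gauge_diameter K C \<le> 2 * circumradius K C" by (simp add: gauge_diameter_def)
qed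

lemma differences_within_half_gauge_diameter:
  fixes K C :: "'a::euclidean_space set"
  assumes K: "K \<in> convex_bodies" and C: "C \<in> convex_bodies" "full_dimensional C"
  shows "differences_within (gauge_diameter K C / 2) K C"
  unfolding differences_within_def
proof (intro ballI)
  fix x y assume xy: "x \<in> K" "y \<in> K"
  let ?r = "circumradius {x, y} C"
  obtain t where t: "0 \<le> ?r" "(+) t ` {x, y} \<subseteq> (*\<^sub>R) ?r ` C"
    using circumradius_nonneg[OF _ _ C, of "{x, y}"] circumradius_containment[OF _ _ C, of "{x, y}"]
    by auto
  then obtain p q where pq: "p \<in> C" "q \<in> C" "t + x = ?r *\<^sub>R p" "t + y = ?r *\<^sub>R q" by blast
  have "x - y = (t + x) - (t + y)" by simp
  also have "\<dots> = ?r *\<^sub>R (p - q)" unfolding pq(3,4) by (simp add: scaleR_diff_right)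
  finally show "\<exists>r\<in>{0..gauge_diameter K C / 2}. \<exists>p\<in>C. \<exists>q\<in>C. x - y = r *\<^sub>R (p - q)"
    using t(1) pq(1,2) half_gauge_diameter_bounds(1)[OF K C xy]
    by (intro bexI[of _ ?r] bexI[of _ p] bexI[of _ q]) auto
qed

text \<open>
  A homothet of \<open>C\<close> inside another one cannot be larger, as a comparison of Euclidean diameters shows;
  full dimension ensures that the diameter is positive.
\<close>

lemma inner_homothet_le_circumradius:
  fixes K C :: "'a::euclidean_space set"
  assumes K: "K \<in> convex_bodies" and C: "C \<in> convex_bodies" "full_dimensional C"
    and l: "0 \<le> l" "(*\<^sub>R) l ` C \<subseteq> (+) s ` K"
  shows "l \<le> circumradius K C"
proof -
  have K': "compact K" "K \<noteq> {}" using K by (auto simp: convex_bodies_def)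
  have C': "compact C" "C \<noteq> {}" using C by (auto simp: convex_bodies_def)
  obtain t where t: "0 \<le> circumradius K C" "(+) t ` K \<subseteq> (*\<^sub>R) (circumradius K C) ` C"
    using circumradius_nonneg[OF K' C] circumradius_containment[OF K' C] by blast
  obtain x y where xy: "x \<in> C" "y \<in> C" "dist x y = diameter C"
    using diameter_compact_attained[OF C'] by blast
  obtain z e where z: "0 < e" "cball z e \<subseteq> C" using full_dimensional_contains_ball[OF C] .
  obtain b :: 'a where b: "b \<in> Basis" using nonempty_Basis by blast
  have "z + e *\<^sub>R b \<in> C" "z \<in> C" using z b by (auto simp: dist_norm)
  from diameter_bounded_bound[OF compact_imp_bounded[OF C'(1)] this]
  have pos: "0 < diameter C" using z(1) b by (simp add: dist_norm)
  obtain x' y' where k: "x' \<in> K" "y' \<in> K" "l *\<^sub>R x = s + x'" "l *\<^sub>R y = s + y'"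
    using l(2) xy by blast
  obtain p q where pq: "p \<in> C" "q \<in> C" "t + x' = circumradius K C *\<^sub>R p" "t + y' = circumradius K C *\<^sub>R q"
    using t(2) k(1,2) by blast
  have "l *\<^sub>R (x - y) = (t + x') - (t + y')" using k(3,4) by (simp add: scaleR_diff_right)
  also have "\<dots> = circumradius K C *\<^sub>R (p - q)" unfolding pq(3,4) by (simp add: scaleR_diff_right)
  finally have "norm (l *\<^sub>R (x - y)) = norm (circumradius K C *\<^sub>R (p - q))" by simp
  then have "l * diameter C = circumradius K C * dist p q"
    using l(1) t(1) xy(3) by (simp add: dist_norm)
  also have "\<dots> \<le> circumradius K C * diameter C"
    using diameter_bounded_bound[OF compact_imp_bounded[OF C'(1)] pq(1,2)] t(1)
    by (rule mult_left_mono)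
  finally show ?thesis using pos by simp
qed

lemma inradius_properties:
  fixes K C :: "'a::euclidean_space set"
  assumes K: "K \<in> convex_bodies" and C: "C \<in> convex_bodies" "full_dimensional C"
  shows le_inradius: "0 \<le> l \<Longrightarrow> (*\<^sub>R) l ` C \<subseteq> (+) s ` K \<Longrightarrow> l \<le> inradius K C"
    and inradius_le: "(\<And>l s. 0 \<le> l \<Longrightarrow> (*\<^sub>R) l ` C \<subseteq> (+) s ` K \<Longrightarrow> l \<le> B) \<Longrightarrow> inradius K C \<le> B"
    and inradius_nonneg: "0 \<le> inradius K C"
    and inradius_le_circumradius: "inradius K C \<le> circumradius K C"
proof -
  let ?A = "{l. 0 \<le> l \<and> (\<exists>t. (*\<^sub>R) l ` C \<subseteq> (+) t ` K)}"
  have bdd: "bdd_above ?A"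
    using inner_homothet_le_circumradius[OF K C] by (intro bdd_aboveI[of _ "circumradius K C"]) blast
  show le: "l \<le> inradius K C" if "0 \<le> l" "(*\<^sub>R) l ` C \<subseteq> (+) s ` K" for l s
    unfolding inradius_def using that by (intro cSup_upper bdd) blast
  obtain x where x: "x \<in> K" using K by (auto simp: convex_bodies_def)
  have zero: "(*\<^sub>R) 0 ` C \<subseteq> (+) (- x) ` K"
  proof clarify
    fix c show "0 *\<^sub>R c \<in> (+) (- x) ` K" using x by (intro image_eqI[of _ _ x]) auto
  qed
  show "0 \<le> inradius K C" by (rule le[OF order_refl zero])
  have ne: "?A \<noteq> {}" using zero by blast
  show least: "inradius K C \<le> B" if "\<And>l s. 0 \<le> l \<Longrightarrow> (*\<^sub>R) l ` C \<subseteq> (+) s ` K \<Longrightarrow> l \<le> B" for B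
    unfolding inradius_def using that by (intro cSup_least[OF ne]) blast
  show "inradius K C \<le> circumradius K C"
    by (rule least) (rule inner_homothet_le_circumradius[OF K C])
qed

lemma circumradius_zero_imp_singleton:
  fixes K C :: "'a::euclidean_space set"
  assumes K: "K \<in> convex_bodies" and C: "C \<in> convex_bodies" "full_dimensional C"
    and R: "circumradius K C = 0"
  shows "is_singleton K"
proof -
  have K': "compact K" "K \<noteq> {}" using K by (auto simp: convex_bodies_def)
  obtain t where "(+) t ` K \<subseteq> (*\<^sub>R) 0 ` C"
    using circumradius_containment[OF K' C] R by auto
  then have "t + x = 0" if "x \<in> K" for x using that by fastforce
  then have "x = - t" if "x \<in> K" for x using that by (metis add_eq_0_iff)
  then show ?thesis using K'(2) by (intro is_singletonI') auto
qed

section \<open>The planar inequalities\<close>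

text \<open>
  An optimal translate of \<open>K\<close> and the gauge scaled by the circumradius form a pair of circumradius
  \<open>1\<close>, in which \<open>d\<close> is half the diameter; the bounds on homothets apply to this pair and are scaled
  back.
\<close>

lemma planar_inequalities_positive_circumradius:
  fixes K C :: "(real^2) set"
  assumes K: "K \<in> convex_bodies" and C: "C \<in> convex_bodies" "full_dimensional C"
    and R: "0 < circumradius K C"
  shows "4 * inradius K C + 2 * circumradius K C \<le> 3 * gauge_diameter K C"
    and "gauge_diameter K C * (2 * circumradius K C - gauge_diameter K C)
      \<le> 4 * inradius K C * circumradius K C"
proof -
  let ?R = "circumradius K C"
  define d where "d = gauge_diameter K C / 2 / ?R"
  have d: "0 \<le> d" "d \<le> 1"
    using half_gauge_diameter_bounds(2,3)[OF K C] R by (auto simp: d_def field_simps)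
  have K': "compact K" "K \<noteq> {}" "convex K" using K by (auto simp: convex_bodies_def)
  have C': "convex C" "compact C" "C \<noteq> {}" using C by (auto simp: convex_bodies_def)
  obtain t where t: "(+) t ` K \<subseteq> (*\<^sub>R) ?R ` C"
    and min: "\<And>l t. 0 \<le> l \<Longrightarrow> (+) t ` K \<subseteq> (*\<^sub>R) l ` C \<Longrightarrow> ?R \<le> l"
    using circumradius_containment[OF K'(1,2) C] circumradius_le[OF K'(1,2) C] by blast
  define K1 where "K1 = (+) t ` K"
  define C1 where "C1 = (*\<^sub>R) ?R ` C"
  have K1: "compact K1" "K1 \<noteq> {}" "convex K1"
    unfolding K1_def using K' by (auto intro: compact_translation convex_translation)
  have C1: "convex C1" "compact C1" "C1 \<noteq> {}"
    unfolding C1_def using C' by (auto intro: convex_scaling compact_scaling)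
  have sub: "K1 \<subseteq> C1" using t by (simp add: K1_def C1_def)
  have opt: "1 \<le> l" if l: "0 \<le> l" "(+) u ` K1 \<subseteq> (*\<^sub>R) l ` C1" for l u
  proof -
    have "(+) (u + t) ` K \<subseteq> (*\<^sub>R) (l * ?R) ` C"
      using l(2) by (simp add: K1_def C1_def image_image add.assoc)
    then have "?R \<le> l * ?R" using min[of "l * ?R"] l(1) R by simp
    then show ?thesis using R by simp
  qed
  obtain v1 v2 v3 p1 p2 p3 where v: "v1 + v2 + v3 = 0" "\<not> (v1 = 0 \<and> v2 = 0 \<and> v3 = 0)"
    and p: "p1 \<in> K1" "p2 \<in> K1" "p3 \<in> K1"
    and contact: "\<forall>x\<in>C1. v1 \<bullet> x \<le> v1 \<bullet> p1" "\<forall>x\<in>C1. v2 \<bullet> x \<le> v2 \<bullet> p2"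
      "\<forall>x\<in>C1. v3 \<bullet> x \<le> v3 \<bullet> p3"
    by (rule optimal_containment_touching_triple[OF K1(1,2) C1 sub opt]) (assumption | rule that)+
  note sup = contact[THEN bspec]
  obtain z e where ze: "0 < e" "cball z e \<subseteq> C" using full_dimensional_contains_ball[OF C] .
  have "cball (?R *\<^sub>R z) (?R * e) \<subseteq> C1"
  proof -
    have "cball (?R *\<^sub>R z) (?R * e) = (*\<^sub>R) ?R ` cball z e"
      using cball_scale[of ?R z e] R by simp
    then show ?thesis using ze(2) by (auto simp: C1_def)
  qed
  with R ze(1) have ball: "0 < ?R * e" "cball (?R *\<^sub>R z) (?R * e) \<subseteq> C1" by auto
  have dw: "differences_within d K1 C1"
    unfolding differences_within_def
  proof (intro ballI)
    fix x y assume "x \<in> K1" "y \<in> K1"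
    then obtain x' y' where xy: "x = t + x'" "y = t + y'" "x' \<in> K" "y' \<in> K" by (auto simp: K1_def)
    obtain r p q where r: "0 \<le> r" "r \<le> gauge_diameter K C / 2" "p \<in> C" "q \<in> C"
        "x' - y' = r *\<^sub>R (p - q)"
      using differences_within_half_gauge_diameter[OF K C] xy(3,4)
      unfolding differences_within_def by fastforce
    have "r / ?R \<in> {0..d}" using divide_right_mono[OF r(2), of ?R] r(1) R by (simp add: d_def)
    moreover have "x - y = (r / ?R) *\<^sub>R (?R *\<^sub>R p - ?R *\<^sub>R q)"
      using r(5) xy(1,2) R by (simp add: scaleR_diff_right)
    moreover have "?R *\<^sub>R p \<in> C1" "?R *\<^sub>R q \<in> C1" using r(3,4) by (auto simp: C1_def)
    ultimately show "\<exists>r\<in>{0..d}. \<exists>p\<in>C1. \<exists>q\<in>C1. x - y = r *\<^sub>R (p - q)" by blast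
  qed
  have D: "gauge_diameter K C = 2 * d * ?R" using R by (simp add: d_def)
  have "inradius K C \<le> (3 * d - 1) / 2 * ?R"
  proof (rule inradius_le[OF K C])
    fix l s assume l: "0 \<le> l" "(*\<^sub>R) l ` C \<subseteq> (+) s ` K"
    have "(t - s) + (l / ?R) *\<^sub>R x \<in> K1" if x: "x \<in> C1" for x
    proof -
      obtain c where c: "c \<in> C" "x = ?R *\<^sub>R c" using x by (auto simp: C1_def)
      obtain k where "k \<in> K" "l *\<^sub>R c = s + k" using l(2) c(1) by blast
      then show ?thesis using R c(2) by (auto simp: K1_def)
    qed
    then have "2 * (l / ?R) + 1 \<le> 3 * d"
      by (intro inscribed_homothet_upper_bound[OF C1(2) ball sub v p sup dw]) auto
    then show "l \<le> (3 * d - 1) / 2 * ?R" using R by (simp add: field_simps)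
  qed
  then show "4 * inradius K C + 2 * circumradius K C \<le> 3 * gauge_diameter K C"
    unfolding D by (simp add: algebra_simps)
  have "d * (1 - d) * ?R \<le> inradius K C"
  proof (cases "d < 1")
    case True
    obtain l w where l: "d * (1 - d) \<le> l" "0 \<le> l" "\<forall>x\<in>C1. w + l *\<^sub>R x \<in> K1"
      by (rule inscribed_homothet_lower_bound[OF K1(3) ball sub v p sup dw d(1) True]) (assumption | rule that)+
    have "(*\<^sub>R) (l * ?R) ` C \<subseteq> (+) (t - w) ` K"
    proof clarify
      fix c assume "c \<in> C"
      then have "w + l *\<^sub>R (?R *\<^sub>R c) \<in> K1" using l(3) by (auto simp: C1_def)
      then obtain k where "k \<in> K" "w + l *\<^sub>R (?R *\<^sub>R c) = t + k" by (auto simp: K1_def)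
      then show "(l * ?R) *\<^sub>R c \<in> (+) (t - w) ` K"
        by (intro image_eqI[of _ _ k]) (auto simp: algebra_simps)
    qed
    then have "l * ?R \<le> inradius K C" using l(2) R by (intro le_inradius[OF K C]) auto
    moreover have "d * (1 - d) * ?R \<le> l * ?R" using l(1) R by (intro mult_right_mono) auto
    ultimately show ?thesis by linarith
  next
    case False
    then show ?thesis using d inradius_nonneg[OF K C] by simp
  qed
  then have "4 * (d * (1 - d) * ?R) * ?R \<le> 4 * inradius K C * ?R"
    using R by (intro mult_right_mono) auto
  then show "gauge_diameter K C * (2 * circumradius K C - gauge_diameter K C)
      \<le> 4 * inradius K C * circumradius K C"
    unfolding D by (simp add: algebra_simps)
qed

lemma planar_inequalities:
  fixes K C :: "(real^2) set"
  assumes K: "K \<in> convex_bodies" and C: "C \<in> convex_bodies" "full_dimensional C"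
  shows "4 * inradius K C + 2 * circumradius K C \<le> 3 * gauge_diameter K C"
    and "gauge_diameter K C * (2 * circumradius K C - gauge_diameter K C)
      \<le> 4 * inradius K C * circumradius K C"
proof -
  note b = half_gauge_diameter_bounds(2,3)[OF K C] inradius_nonneg[OF K C]
    inradius_le_circumradius[OF K C]
  consider "circumradius K C = 0" | "0 < circumradius K C" using b by linarith
  then have "4 * inradius K C + 2 * circumradius K C \<le> 3 * gauge_diameter K C \<and>
    gauge_diameter K C * (2 * circumradius K C - gauge_diameter K C)
      \<le> 4 * inradius K C * circumradius K C"
  proof cases
    case 1
    then have "gauge_diameter K C = 0" "inradius K C = 0" using b by auto
    then show ?thesis using 1 by simp
  next
    case 2
    then show ?thesis using planar_inequalities_positive_circumradius[OF K C] by blast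
  qed
  then show "4 * inradius K C + 2 * circumradius K C \<le> 3 * gauge_diameter K C"
    and "gauge_diameter K C * (2 * circumradius K C - gauge_diameter K C)
      \<le> 4 * inradius K C * circumradius K C" by auto
qed

lemma bs_diagram_subset:
  "bs_diagram TYPE(real ^ 2) \<subseteq>
    {(x, y). (x, y) \<in> {0..1} \<times> {0..1} \<and> y \<le> 1 \<and> 2 * x + 1 \<le> 3 * y \<and> y * (1 - y) \<le> x}"
proof -
  have "0 \<le> r / R \<and> r / R \<le> 1 \<and> 0 \<le> D / (2 * R) \<and> D / (2 * R) \<le> 1 \<and>
      2 * (r / R) + 1 \<le> 3 * (D / (2 * R)) \<and> D / (2 * R) * (1 - D / (2 * R)) \<le> r / R"
    if "0 < R" "0 \<le> r" "r \<le> R" "0 \<le> D" "D \<le> 2 * R" "4 * r + 2 * R \<le> 3 * D"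
      "D * (2 * R - D) \<le> 4 * r * R" for r R D :: real
  proof -
    define x y where "x = r / R" and "y = D / (2 * R)"
    have r: "r = R * x" and D: "D = R * (2 * y)" using that(1) by (simp_all add: x_def y_def)
    have "R * 0 \<le> R * x" "R * x \<le> R * 1" "R * 0 \<le> R * (2 * y)" "R * (2 * y) \<le> R * 2"
      "R * (4 * x + 2) \<le> R * (6 * y)" "(R * R) * (4 * (y * (1 - y))) \<le> (R * R) * (4 * x)"
      using that(2-7) unfolding r D by (simp_all add: algebra_simps)
    then have "0 \<le> x" "x \<le> 1" "0 \<le> 2 * y" "2 * y \<le> 2" "4 * x + 2 \<le> 6 * y" "4 * (y * (1 - y)) \<le> 4 * x"
      using that(1) mult_le_cancel_left_pos[of R] mult_le_cancel_left_pos[of "R * R"]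
      by (simp_all add: zero_le_mult_iff)
    then show ?thesis unfolding x_def[symmetric] y_def[symmetric] by linarith
  qed
  note arith = this
  show ?thesis
  proof
    fix z assume "z \<in> bs_diagram TYPE(real^2)"
    then obtain K C :: "(real^2) set" where z: "z = bs_map K C" and K: "K \<in> convex_bodies"
      and C: "C \<in> convex_bodies" "full_dimensional C" and ns: "\<not> is_singleton K"
      by (auto simp: bs_diagram_def)
    note b = half_gauge_diameter_bounds(2,3)[OF K C] inradius_nonneg[OF K C]
      inradius_le_circumradius[OF K C]
    have "circumradius K C \<noteq> 0" using circumradius_zero_imp_singleton[OF K C] ns by blast
    then have "0 < circumradius K C" using b by linarith
    from arith[OF this b(3,4,1,2) planar_inequalities[OF K C]]
    show "z \<in> {(x, y). (x, y) \<in> {0..1} \<times> {0..1} \<and> y \<le> 1 \<and> 2 * x + 1 \<le> 3 * y \<and> y * (1 - y) \<le> x}"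
      by (simp add: z bs_map_def)
  qed
qed

section \<open>Polygons realising the whole region\<close>

lemma halfplane_convex_closed:
  fixes a b c :: real
  shows "convex {p::real^2. a * p $ 1 + b * p $ 2 \<le> c}" "closed {p::real^2. a * p $ 1 + b * p $ 2 \<le> c}"
proof -
  have "{p::real^2. a * p $ 1 + b * p $ 2 \<le> c} = {p. vector [a, b] \<bullet> p \<le> c}"
    by (simp add: inner_vec_def sum_2)
  then show "convex {p::real^2. a * p $ 1 + b * p $ 2 \<le> c}" "closed {p::real^2. a * p $ 1 + b * p $ 2 \<le> c}"
    by (simp_all add: convex_halfspace_le closed_halfspace_le)
qed

definition corner_triangle :: "(real^2) set" where
  "corner_triangle = {p. 0 \<le> p $ 1 \<and> 0 \<le> p $ 2 \<and> p $ 1 + p $ 2 \<le> 1}"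

text \<open>
  With barycentric coordinates \<open>(u, v, w)\<close>, \<open>w = 1 - u - v\<close>, this is the part of the triangle where
  \<open>u \<le> k\<close>, \<open>v \<le> d\<close>, \<open>w \<le> d\<close> and \<open>w \<le> d - s (1 - d - u)\<close>. The bounds by \<open>d\<close> limit the diameter. The
  parameters \<open>k\<close> and \<open>s\<close> cut down the inradius while keeping the points \<open>(0, d)\<close>, \<open>(1 - d, 0)\<close> and
  \<open>(1 - d, d)\<close>, which fix circumradius and diameter: they lie on the three sides, and the last two are
  at distance \<open>d\<close> on a line parallel to a side. The line bounding the last condition turns around
  \<open>(1 - d, 0)\<close> as \<open>s\<close> varies.
\<close>

definition cut_triangle :: "real \<Rightarrow> real \<Rightarrow> real \<Rightarrow> (real^2) set" where
  "cut_triangle d k s = {p \<in> corner_triangle. p $ 1 \<le> k \<and> p $ 2 \<le> d \<and>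
    1 - p $ 1 - p $ 2 \<le> d \<and> 1 - p $ 1 - p $ 2 \<le> d - s * (1 - d - p $ 1)}"

lemma corner_triangle_convex_closed: "convex corner_triangle" "closed corner_triangle"
proof -
  have eq: "corner_triangle = {p. (-1) * p $ 1 + 0 * p $ 2 \<le> 0} \<inter> {p. 0 * p $ 1 + (-1) * p $ 2 \<le> 0} \<inter>
      {p. 1 * p $ 1 + 1 * p $ 2 \<le> 1}"
    by (auto simp: corner_triangle_def)
  show "convex corner_triangle" "closed corner_triangle"
    unfolding eq by (intro convex_Int closed_Int halfplane_convex_closed)+
qed

lemma corner_triangle_bounded: "bounded corner_triangle"
proof (rule boundedI)
  fix p assume "p \<in> corner_triangle"
  then show "norm p \<le> 1"
    using norm_le_l1_cart[of p] by (auto simp: corner_triangle_def sum_2)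
qed

lemma corner_triangle_body: "corner_triangle \<in> convex_bodies" "full_dimensional corner_triangle"
proof -
  have "(0::real^2) \<in> corner_triangle" by (simp add: corner_triangle_def)
  then show "corner_triangle \<in> convex_bodies"
    using corner_triangle_convex_closed corner_triangle_bounded
    by (auto simp: convex_bodies_def compact_eq_bounded_closed)
  have "ball (vector [1/4, 1/4]) (1/4) \<subseteq> corner_triangle"
  proof
    fix p :: "real^2" assume "p \<in> ball (vector [1/4, 1/4]) (1/4)"
    then have "norm (p - vector [1/4, 1/4]) < 1/4" by (simp add: dist_norm norm_minus_commute)
    then have "\<bar>p $ 1 - 1/4\<bar> < 1/4" "\<bar>p $ 2 - 1/4\<bar> < 1/4"
      using component_le_norm_cart[of "p - vector [1/4, 1/4]" 1]
        component_le_norm_cart[of "p - vector [1/4, 1/4]" 2] by auto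
    then show "p \<in> corner_triangle" unfolding corner_triangle_def mem_Collect_eq by linarith
  qed
  moreover have "vector [1/4, 1/4] \<in> ball (vector [1/4, 1/4] :: real^2) (1/4)" by simp
  ultimately have "interior corner_triangle \<noteq> {}"
    using open_ball interior_maximal by blast
  then show "full_dimensional corner_triangle"
    by (simp add: full_dimensional_def aff_dim_nonempty_interior)
qed

lemma cut_triangle_convex_compact: "convex (cut_triangle d k s)" "compact (cut_triangle d k s)"
proof -
  have eq: "cut_triangle d k s = corner_triangle \<inter> {p. 1 * p $ 1 + 0 * p $ 2 \<le> k} \<inter>
      {p. 0 * p $ 1 + 1 * p $ 2 \<le> d} \<inter> {p. (-1) * p $ 1 + (-1) * p $ 2 \<le> d - 1} \<inter>
      {p. (- 1 - s) * p $ 1 + (-1) * p $ 2 \<le> d - 1 - s * (1 - d)}"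
    by (auto simp: cut_triangle_def algebra_simps)
  show "convex (cut_triangle d k s)"
    unfolding eq by (intro convex_Int halfplane_convex_closed corner_triangle_convex_closed)
  have "closed (cut_triangle d k s)"
    unfolding eq by (intro closed_Int halfplane_convex_closed corner_triangle_convex_closed)
  moreover have "bounded (cut_triangle d k s)"
    by (rule bounded_subset[OF corner_triangle_bounded]) (auto simp: cut_triangle_def)
  ultimately show "compact (cut_triangle d k s)" by (simp add: compact_eq_bounded_closed)
qed

lemma mem_scaled_corner_triangle:
  assumes "0 \<le> l"
  shows "q \<in> (*\<^sub>R) l ` corner_triangle \<longleftrightarrow> 0 \<le> q $ 1 \<and> 0 \<le> q $ 2 \<and> q $ 1 + q $ 2 \<le> l"
proof
  assume "q \<in> (*\<^sub>R) l ` corner_triangle"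
  then obtain p where p: "p \<in> corner_triangle" "q = l *\<^sub>R p" by auto
  have "l * (p $ 1 + p $ 2) \<le> l * 1"
    using p(1) assms by (intro mult_left_mono) (auto simp: corner_triangle_def)
  then show "0 \<le> q $ 1 \<and> 0 \<le> q $ 2 \<and> q $ 1 + q $ 2 \<le> l"
    using p assms by (simp add: corner_triangle_def distrib_left)
next
  assume q: "0 \<le> q $ 1 \<and> 0 \<le> q $ 2 \<and> q $ 1 + q $ 2 \<le> l"
  show "q \<in> (*\<^sub>R) l ` corner_triangle"
  proof (cases "l = 0")
    case True
    then have "q $ 1 = 0" "q $ 2 = 0" using q by linarith+
    then have "q = l *\<^sub>R 0" by (simp add: vec_eq_iff forall_2)
    moreover have "(0::real^2) \<in> corner_triangle" by (simp add: corner_triangle_def)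
    ultimately show ?thesis by blast
  next
    case False
    then have "0 < l" using assms by simp
    then have "q /\<^sub>R l \<in> corner_triangle" using q
      by (simp add: corner_triangle_def field_simps)
    moreover have "q = l *\<^sub>R (q /\<^sub>R l)" using \<open>0 < l\<close> by simp
    ultimately show ?thesis by blast
  qed
qed

lemma cut_triangle_touching_points:
  assumes "d \<le> 1" "1/2 \<le> d" "1 - d \<le> k" "s * (1 - d) \<le> 2 * d - 1"
  shows "vector [0, d] \<in> cut_triangle d k s" "vector [1 - d, 0] \<in> cut_triangle d k s"
    "vector [1 - d, d] \<in> cut_triangle d k s"
  using assms by (auto simp: cut_triangle_def corner_triangle_def)

lemma cut_triangle_body:
  assumes "d \<le> 1" "1/2 \<le> d" "1 - d \<le> k" "s * (1 - d) \<le> 2 * d - 1"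
  shows "cut_triangle d k s \<in> convex_bodies" "\<not> is_singleton (cut_triangle d k s)"
proof -
  note p = cut_triangle_touching_points[OF assms]
  show "cut_triangle d k s \<in> convex_bodies"
    using cut_triangle_convex_compact p by (auto simp: convex_bodies_def)
  have "(vector [1 - d, 0] :: real^2) $ 2 \<noteq> (vector [1 - d, d] :: real^2) $ 2"
    using assms by simp
  then show "\<not> is_singleton (cut_triangle d k s)"
    using p(2,3) by (metis is_singletonE singletonD)
qed

lemma circumradius_cut_triangle:
  assumes "d \<le> 1" "1/2 \<le> d" "1 - d \<le> k" "s * (1 - d) \<le> 2 * d - 1"
  shows "circumradius (cut_triangle d k s) corner_triangle = 1"
proof -
  note p = cut_triangle_touching_points[OF assms]
  have K: "compact (cut_triangle d k s)" "cut_triangle d k s \<noteq> {}"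
    using cut_triangle_convex_compact p by auto
  note c = circumradius_nonneg[OF K corner_triangle_body] circumradius_containment[OF K corner_triangle_body]
  have incl: "(+) 0 ` cut_triangle d k s \<subseteq> (*\<^sub>R) 1 ` corner_triangle"
    by (auto simp: cut_triangle_def corner_triangle_def mem_scaled_corner_triangle)
  have le: "circumradius (cut_triangle d k s) corner_triangle \<le> 1"
    by (rule circumradius_le[OF K corner_triangle_body zero_le_one incl])
  obtain t where t: "(+) t ` cut_triangle d k s
      \<subseteq> (*\<^sub>R) (circumradius (cut_triangle d k s) corner_triangle) ` corner_triangle"
    using c(2) by blast
  have "0 \<le> t $ 1"
    using subsetD[OF t imageI[OF p(1)]] by (simp add: mem_scaled_corner_triangle[OF c(1)])
  moreover have "0 \<le> t $ 2"
    using subsetD[OF t imageI[OF p(2)]] by (simp add: mem_scaled_corner_triangle[OF c(1)])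
  moreover have "t $ 1 + (1 - d) + (t $ 2 + d) \<le> circumradius (cut_triangle d k s) corner_triangle"
    using subsetD[OF t imageI[OF p(3)]] by (simp add: mem_scaled_corner_triangle[OF c(1)])
  ultimately show ?thesis using le by linarith
qed

lemma gauge_diameter_cut_triangle:
  assumes d: "d \<le> 1" "1/2 \<le> d" and k: "1 - d \<le> k" "k \<le> d" and s: "s * (1 - d) \<le> 2 * d - 1"
  shows "gauge_diameter (cut_triangle d k s) corner_triangle = 2 * d"
proof -
  let ?K = "cut_triangle d k s"
  note p = cut_triangle_touching_points[OF d k(1) s]
  have le: "circumradius {x, y} corner_triangle \<le> d" if xy: "x \<in> ?K" "y \<in> ?K" for x y
  proof -
    \<comment> \<open>Move the corner of the bounding box of the two points to the origin.\<close>
    define t :: "real^2" where "t = vector [- min (x $ 1) (y $ 1), - min (x $ 2) (y $ 2)]"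
    have incl: "(+) t ` {x, y} \<subseteq> (*\<^sub>R) d ` corner_triangle"
    proof -
      have "t + z \<in> (*\<^sub>R) d ` corner_triangle" if "z \<in> {x, y}" for z
      proof -
        have "0 \<le> d" using d by simp
        moreover have "0 \<le> (t + z) $ 1" "0 \<le> (t + z) $ 2" "(t + z) $ 1 + (t + z) $ 2 \<le> d"
          using that xy k(2) by (auto simp: t_def cut_triangle_def corner_triangle_def min_def)
        ultimately show ?thesis by (simp only: mem_scaled_corner_triangle)
      qed
      then show ?thesis by blast
    qed
    show ?thesis by (rule circumradius_le[OF _ _ corner_triangle_body _ incl]) (use d in auto)
  qed
  have "d \<le> circumradius {vector [1 - d, 0], vector [1 - d, d]} corner_triangle" (is "d \<le> ?c")
  proof -
    have c: "0 \<le> ?c" by (rule circumradius_nonneg[OF _ _ corner_triangle_body]) auto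
    obtain t where t: "(+) t ` {vector [1 - d, 0], vector [1 - d, d]} \<subseteq> (*\<^sub>R) ?c ` corner_triangle"
      using circumradius_containment[OF _ _ corner_triangle_body, of "{vector [1 - d, 0], vector [1 - d, d]}"]
      by auto
    have "t + vector [1 - d, 0] \<in> (*\<^sub>R) ?c ` corner_triangle"
      "t + vector [1 - d, d] \<in> (*\<^sub>R) ?c ` corner_triangle"
      using t by auto
    then show ?thesis unfolding mem_scaled_corner_triangle[OF c] by simp
  qed
  with le[OF p(2,3)] have "?c = d" by linarith
  then have "d \<in> {circumradius {x, y} corner_triangle |x y. x \<in> ?K \<and> y \<in> ?K}"
    using p(2,3) by (intro CollectI exI[of _ "vector [1 - d, 0]"] exI[of _ "vector [1 - d, d]"]) simp
  then have "Sup {circumradius {x, y} corner_triangle |x y. x \<in> ?K \<and> y \<in> ?K} = d"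
    by (rule cSup_eq_maximum) (use le in auto)
  then show ?thesis by (simp add: gauge_diameter_def)
qed

text \<open>
  A copy of the triangle with corner \<open>(m1, m2)\<close> and scale \<open>l\<close> attains the extreme values of the
  coordinates at its vertices, so a few vertex conditions suffice for the upper bound.
\<close>

lemma inradius_cut_triangleI:
  assumes x: "0 \<le> x"
    and inner: "\<And>c. c \<in> corner_triangle \<Longrightarrow> m + x *\<^sub>R c \<in> cut_triangle d k s"
    and upper: "\<And>l m1 m2. 0 \<le> l \<Longrightarrow> 0 \<le> m1 \<Longrightarrow> m1 + l \<le> k \<Longrightarrow> m2 + l \<le> d \<Longrightarrow>
      1 - m1 - m2 \<le> d \<Longrightarrow> 1 - m1 - m2 \<le> d - s * (1 - d - m1) \<Longrightarrow> l \<le> x"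
  shows "inradius (cut_triangle d k s) corner_triangle = x"
  unfolding inradius_def
proof (rule cSup_eq_maximum)
  have "(*\<^sub>R) x ` corner_triangle \<subseteq> (+) (- m) ` cut_triangle d k s"
  proof clarify
    fix c assume "c \<in> corner_triangle"
    then show "x *\<^sub>R c \<in> (+) (- m) ` cut_triangle d k s"
      using inner by (intro image_eqI[of _ _ "m + x *\<^sub>R c"]) auto
  qed
  then show "x \<in> {l. 0 \<le> l \<and> (\<exists>t. (*\<^sub>R) l ` corner_triangle \<subseteq> (+) t ` cut_triangle d k s)}"
    using x by blast
  fix l assume "l \<in> {l. 0 \<le> l \<and> (\<exists>t. (*\<^sub>R) l ` corner_triangle \<subseteq> (+) t ` cut_triangle d k s)}"
  then obtain t where l: "0 \<le> l" and t: "(*\<^sub>R) l ` corner_triangle \<subseteq> (+) t ` cut_triangle d k s" by blast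
  have mem: "l *\<^sub>R c - t \<in> cut_triangle d k s" if "c \<in> corner_triangle" for c
  proof -
    have "l *\<^sub>R c \<in> (+) t ` cut_triangle d k s" using t that by blast
    then show ?thesis by auto
  qed
  have "0 \<in> corner_triangle" "vector [1, 0] \<in> corner_triangle" "vector [0, 1] \<in> corner_triangle"
    by (auto simp: corner_triangle_def)
  from this[THEN mem] show "l \<le> x"
    by (intro upper[of l "- t $ 1" "- t $ 2"] l) (auto simp: cut_triangle_def corner_triangle_def)
qed

text \<open>
  For fixed diameter, large inradii are reached with \<open>s = 0\<close> by varying \<open>k\<close>: there the inradius is
  the smaller of \<open>k\<close> and \<open>(k + 2 y - 1) / 2\<close>. At \<open>k = 1 - y\<close> this leaves inradii below both \<open>1 - y\<close> and
  \<open>y / 2\<close>; those are reached with \<open>k = 1 - y\<close> by tilting the last cut, where the inradius is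
  \<open>y / (2 + s)\<close>, until the body is the triangle with vertices \<open>(0, y)\<close>, \<open>(1 - y, 0)\<close> and \<open>(1 - y, y)\<close>.
\<close>

lemma bs_diagram_supset:
  fixes x y :: real
  assumes "0 \<le> x" "y \<le> 1" "0 \<le> y" "2 * x + 1 \<le> 3 * y" "y * (1 - y) \<le> x"
  shows "(x, y) \<in> bs_diagram TYPE(real^2)"
proof -
  have "0 \<le> (2 * y - 1) * (y + 1)" using assms(4,5) by (simp add: algebra_simps)
  then have y: "1/2 \<le> y" using assms(3) by (simp add: zero_le_mult_iff)
  have xy: "x \<le> y" using assms(2,4) by linarith
  obtain k s where ks: "1 - y \<le> k" "k \<le> y" "s * (1 - y) \<le> 2 * y - 1"
    and r: "inradius (cut_triangle y k s) corner_triangle = x"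
  proof (cases "1 - y \<le> x \<or> y \<le> 2 * x")
    case True
    \<comment> \<open>The inverse of \<open>k \<mapsto> min k ((k + 2 * y - 1) / 2)\<close>, and a corner of an inscribed copy on the
      line \<open>w = y\<close>.\<close>
    define k where "k = max x (2 * x + 1 - 2 * y)"
    define m :: "real^2" where "m = vector [max 0 (1 - 2 * y + x), 1 - y - max 0 (1 - 2 * y + x)]"
    have "inradius (cut_triangle y k 0) corner_triangle = x"
    proof (rule inradius_cut_triangleI[where m = m])
      fix c assume c: "c \<in> corner_triangle"
      then have "0 \<le> x * c $ 1" "0 \<le> x * c $ 2" "x * (c $ 1 + c $ 2) \<le> x * 1"
        using assms(1) mult_left_mono[of "c $ 1 + c $ 2" 1 x] by (auto simp: corner_triangle_def)
      then show "m + x *\<^sub>R c \<in> cut_triangle y k 0"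
        using assms(1,2) xy y
        by (auto simp: cut_triangle_def corner_triangle_def m_def k_def distrib_left max_def)
    next
      fix l m1 m2 :: real
      assume "0 \<le> m1" "m1 + l \<le> k" "m2 + l \<le> y" "1 - m1 - m2 \<le> y"
      then show "l \<le> x" by (auto simp: k_def max_def split: if_splits)
    qed (use assms in auto)
    then show ?thesis using True y xy assms(2,4) that[of k 0] by (auto simp: k_def)
  next
    case False
    then have x: "x < 1 - y" "2 * x < y" by auto
    then have "0 < y * (1 - y)" using y assms(1) by (intro mult_pos_pos) auto
    then have x0: "0 < x" using assms(5) by linarith
    define s where "s = y / x - 2"
    have s: "0 \<le> s" "(2 + s) * x = y" using x x0 by (auto simp: s_def field_simps)
    have "x * (s * (1 - y)) = (y - 2 * x) * (1 - y)"
      unfolding s(2)[symmetric] by (simp add: algebra_simps)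
    also have "\<dots> \<le> x * (2 * y - 1)" using assms(5) by (simp add: algebra_simps)
    finally have "x * (s * (1 - y)) \<le> x * (2 * y - 1)" .
    then have s2: "s * (1 - y) \<le> 2 * y - 1" using x0 by simp
    define m :: "real^2" where "m = vector [1 - y - x, y - x]"
    have "inradius (cut_triangle y (1 - y) s) corner_triangle = x"
    proof (rule inradius_cut_triangleI[where m = m])
      fix c assume c: "c \<in> corner_triangle"
      then have "0 \<le> x * c $ 1" "0 \<le> x * c $ 2" "x * (c $ 1 + c $ 2) \<le> x * 1" "0 \<le> s * (x * c $ 1)"
        using assms(1) s(1) mult_left_mono[of "c $ 1 + c $ 2" 1 x] by (auto simp: corner_triangle_def)
      then show "m + x *\<^sub>R c \<in> cut_triangle y (1 - y) s"
        using x s(2) xy y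
        by (auto simp: cut_triangle_def corner_triangle_def m_def algebra_simps)
    next
      fix l m1 m2 :: real
      assume l: "m1 + l \<le> 1 - y" "m2 + l \<le> y" "1 - m1 - m2 \<le> y - s * (1 - y - m1)"
      have "(1 + s) * l \<le> (1 + s) * (1 - y - m1)"
        using l(1) s(1) by (intro mult_left_mono) auto
      then have "(2 + s) * l \<le> (2 + s) * x"
        using l(2,3) unfolding s(2) by (simp add: algebra_simps)
      then show "l \<le> x" using s(1) by simp
    qed (use assms in auto)
    then show ?thesis using that[of "1 - y" s] s2 y by auto
  qed
  note K = cut_triangle_body[OF assms(2) y ks(1,3)]
  have "bs_map (cut_triangle y k s) corner_triangle = (x, y)"
    unfolding bs_map_def circumradius_cut_triangle[OF assms(2) y ks(1,3)]
      gauge_diameter_cut_triangle[OF assms(2) y ks] r by simp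
  then show ?thesis
    unfolding bs_diagram_def using K corner_triangle_body
    by (intro CollectI exI[of _ "cut_triangle y k s"] exI[of _ corner_triangle]) auto
qed

section \<open>The diagram of planar convex bodies\<close>

theorem theorem1p1:
  shows "(\<forall>K \<in> convex_bodies. \<forall>C :: (real ^ 2) set \<in> convex_bodies. full_dimensional C \<longrightarrow>
            gauge_diameter K C \<le> 2 * circumradius K C \<and>
            4 * inradius K C + 2 * circumradius K C \<le> 3 * gauge_diameter K C \<and>
            gauge_diameter K C * (2 * circumradius K C - gauge_diameter K C)
              \<le> 4 * inradius K C * circumradius K C) \<and>
         bs_diagram TYPE(real ^ 2) =
           {(x, y). (x, y) \<in> {0..1} \<times> {0..1} \<and> y \<le> 1 \<and> 2 * x + 1 \<le> 3 * y \<and> y * (1 - y) \<le> x}"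
proof (intro conjI ballI impI)
  show "bs_diagram TYPE(real ^ 2) =
      {(x, y). (x, y) \<in> {0..1} \<times> {0..1} \<and> y \<le> 1 \<and> 2 * x + 1 \<le> 3 * y \<and> y * (1 - y) \<le> x}"
    using bs_diagram_subset bs_diagram_supset by (intro equalityI) auto
qed (auto intro: half_gauge_diameter_bounds(3) planar_inequalities)

end
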